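(* Let $\alpha\ge0$, $1\le\gamma<\infty$, let $\varphi\in\mathcal{L}(\gamma)$ be univalent, let $\theta\in[0,\pi)$, and let $F^\theta_{\alpha\beta}$ be a sense-preserving harmonic mapping in $\mathbb{D}$ which is the horizontal shear of $C^\theta_{\alpha\beta}[\varphi]$ with dilatation $w_{\alpha\beta}=\alpha(1+\beta)w$. Then the following hold. (i) For $\beta\ge1$, $F^\theta_{\alpha\beta}\in\mathcal{SHU}$ for all values of $\alpha$ satisfying $$\alpha\le\frac{1}{2\Big(\gamma+\beta+(1+\beta)\|w^*\|(1+\|w\|)\Big)}.\qquad( * )$$ (ii) For $0\le\beta<1$: (a) if $\beta+2(1+\beta)\|w^*\|(1+\|w\|)\le2(1-\beta)$, then $F^\theta_{\alpha\beta}\in\mathcal{SHU}$ for all values of $\alpha$ satisfying $$\alpha\le\frac{4(1-\beta)}{4(2\gamma+1)(1-\beta)+\big(\beta+2(1+\beta)\|w^*\|(1+\|w\|)\big)^2};$$ (b) if $\beta+2(1+\beta)\|w^*\|(1+\|w\|)>2(1-\beta)$, then $F^\theta_{\alpha\beta}\in\mathcal{SHU}$ for all values of $\alpha$ satisfying inequality $( * )$.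
   Context: $\mathbb{D}=\{z\in\mathbb{C}:|z|<1\}$, $\mathbb{T}=\{z:|z|=1\}$. A family $\mathcal{L}$ of analytic locally univalent functions $\varphi$ in $\mathbb{D}$ normalized by $\varphi(0)=0$, $\varphi'(0)=1$ is a linear invariant family if for every $\varphi\in\mathcal{L}$ and every automorphism $\varphi_a(z)=(z+a)/(1+\overline{a}z)$, $a\in\mathbb{D}$, the function $\frac{(\varphi\circ\varphi_a)(z)-\varphi(a)}{(1-|a|^2)\varphi'(a)}$ belongs to $\mathcal{L}$. Its order is $\gamma=\sup\{|a_2(\varphi)|:\varphi\in\mathcal{L}\}$, where $a_2(\varphi)$ is the second Taylor coefficient of $\varphi$ at $0$. $\mathcal{L}(\gamma)$ denotes a linear invariant family of order $\gamma$, $\gamma\ge1$. Define $$C_{\alpha\beta}[\varphi](z)=\int_0^z\Big(\frac{\varphi(\zeta)}{\zeta(1-\zeta)^{\beta}}\Big)^{\alpha}\,d\zeta,\qquad C^\theta_{\alpha\beta}[\varphi](z)=e^{-i\theta}C_{\alpha\beta}[\varphi](e^{i\theta}z),\qquad z\in\mathbb{D},$$ with the analytic branches of the powers for which the integrand equals $1$ at $\zeta=0$. Let $w$ be an analytic function in $\mathbb{D}$ with $|w(z)|<1$, and $w_{\alpha\beta}(z)=\alpha(1+\beta)w(z)$. The horizontal shear of $C^\theta_{\alpha\beta}[\varphi]$ with dilatation $w_{\alpha\beta}$ is the harmonic mapping $F^\theta_{\alpha\beta}=H+\overline{G}$, with $H,G$ analytic in $\mathbb{D}$, $H-G=C^\theta_{\alpha\beta}[\varphi]$,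 $G'=w_{\alpha\beta}H'$, and normalization $H(0)=G(0)=0$, $H'(0)=1$, $G'(0)=0$. It is sense-preserving if $|H'|^2-|G'|^2>0$ (equivalently $|w_{\alpha\beta}|<1$) in $\mathbb{D}$. $\|w\|=\sup_{z\in\mathbb{D}}|w(z)|$ and $\|w^*\|=\sup_{z\in\mathbb{D}}\frac{|w'(z)|(1-|z|^2)}{1-|w(z)|^2}$. A sense-preserving harmonic mapping $f=h+\overline{g}$ in $\mathbb{D}$ is stable harmonic univalent, written $f\in\mathcal{SHU}$, if all mappings $f_\lambda=h+\lambda\overline{g}$, $\lambda\in\mathbb{T}$, are univalent in $\mathbb{D}$. *)

theory Defs
  imports "HOL-Complex_Analysis.Complex_Analysis"
begin

text \<open>
  Functions on the unit disc are total functions of type \<open>complex \<Rightarrow> complex\<close> whose values off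
  the disc are irrelevant.
\<close>

abbreviation unit_disc :: "complex set" where
  "unit_disc \<equiv> ball 0 1"

definition disc_automorphism :: "complex \<Rightarrow> complex \<Rightarrow> complex" where
  "disc_automorphism a z = (z + a) / (1 + cnj a * z)"

definition koebe_transform :: "(complex \<Rightarrow> complex) \<Rightarrow> complex \<Rightarrow> complex \<Rightarrow> complex" where
  "koebe_transform \<phi> a z =
     (\<phi> (disc_automorphism a z) - \<phi> a) / (of_real (1 - (cmod a)\<^sup>2) * deriv \<phi> a)"

definition locally_univalent :: "(complex \<Rightarrow> complex) \<Rightarrow> bool" where
  "locally_univalent f \<longleftrightarrow>
     (\<forall>z\<in>unit_disc. \<exists>U. open U \<and> z \<in> U \<and> U \<subseteq> unit_disc \<and> inj_on f U)"

text \<open>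
  The Koebe transform is only meaningful on the disc, so closure under it asks for a member of
  the family that agrees with it there.
\<close>

definition linear_invariant_family :: "(complex \<Rightarrow> complex) set \<Rightarrow> bool" where
  "linear_invariant_family L \<longleftrightarrow>
     (\<forall>\<phi>\<in>L. \<phi> holomorphic_on unit_disc \<and> locally_univalent \<phi> \<and> \<phi> 0 = 0 \<and> deriv \<phi> 0 = 1 \<and>
        (\<forall>a\<in>unit_disc. \<exists>\<psi>\<in>L. \<forall>z\<in>unit_disc. \<psi> z = koebe_transform \<phi> a z))"

definition taylor_coeff :: "(complex \<Rightarrow> complex) \<Rightarrow> nat \<Rightarrow> complex" where
  "taylor_coeff f n = (deriv ^^ n) f 0 / fact n"

definition family_order :: "(complex \<Rightarrow> complex) set \<Rightarrow> ereal" where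
  "family_order L = (SUP \<phi>\<in>L. ereal (cmod (taylor_coeff \<phi> 2)))"

text \<open>
  For \<open>f\<close> holomorphic and zero-free on the disc with \<open>f 0 = 1\<close>, the holomorphic logarithm of \<open>f\<close>
  vanishing at \<open>0\<close> exists and is unique on the disc. It is in general not the principal
  logarithm of \<open>f\<close>.
\<close>

definition disc_log :: "(complex \<Rightarrow> complex) \<Rightarrow> complex \<Rightarrow> complex" where
  "disc_log f = (SOME g. g holomorphic_on unit_disc \<and> g 0 = 0 \<and> (\<forall>z\<in>unit_disc. exp (g z) = f z))"

definition disc_power :: "(complex \<Rightarrow> complex) \<Rightarrow> real \<Rightarrow> complex \<Rightarrow> complex" where
  "disc_power f \<alpha> z = exp (of_real \<alpha> * disc_log f z)"

text \<open>
  The quotient \<open>\<phi> \<zeta> / \<zeta>\<close> with its removable singularity at \<open>0\<close> filled in.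
\<close>

definition over_id :: "(complex \<Rightarrow> complex) \<Rightarrow> complex \<Rightarrow> complex" where
  "over_id \<phi> \<zeta> = (if \<zeta> = 0 then deriv \<phi> 0 else \<phi> \<zeta> / \<zeta>)"

text \<open>
  Since \<open>1 - \<zeta>\<close> lies in the right half plane, the principal power \<open>powr\<close> is the analytic branch
  of its \<open>\<beta>\<close>-th power that equals \<open>1\<close> at \<open>\<zeta> = 0\<close>.
\<close>

definition C_op :: "real \<Rightarrow> real \<Rightarrow> (complex \<Rightarrow> complex) \<Rightarrow> complex \<Rightarrow> complex" where
  "C_op \<alpha> \<beta> \<phi> z =
     contour_integral (linepath 0 z)
       (disc_power (\<lambda>\<zeta>. over_id \<phi> \<zeta> / (1 - \<zeta>) powr of_real \<beta>) \<alpha>)"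

definition C_op_rot ::
    "real \<Rightarrow> real \<Rightarrow> real \<Rightarrow> (complex \<Rightarrow> complex) \<Rightarrow> complex \<Rightarrow> complex" where
  "C_op_rot \<theta> \<alpha> \<beta> \<phi> z = exp (- \<i> * of_real \<theta>) * C_op \<alpha> \<beta> \<phi> (exp (\<i> * of_real \<theta>) * z)"

definition harmonic_map ::
    "(complex \<Rightarrow> complex) \<Rightarrow> (complex \<Rightarrow> complex) \<Rightarrow> complex \<Rightarrow> complex" where
  "harmonic_map h g z = h z + cnj (g z)"

text \<open>
  The harmonic mapping \<open>harmonic_map H G\<close> is the horizontal shear of \<open>c\<close> with dilatation \<open>\<omega>\<close>.
\<close>

definition horizontal_shear ::
    "(complex \<Rightarrow> complex) \<Rightarrow> (complex \<Rightarrow> complex) \<Rightarrow>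
     (complex \<Rightarrow> complex) \<Rightarrow> (complex \<Rightarrow> complex) \<Rightarrow> bool" where
  "horizontal_shear c \<omega> H G \<longleftrightarrow>
     H holomorphic_on unit_disc \<and> G holomorphic_on unit_disc \<and>
     (\<forall>z\<in>unit_disc. H z - G z = c z) \<and>
     (\<forall>z\<in>unit_disc. deriv G z = \<omega> z * deriv H z) \<and>
     H 0 = 0 \<and> G 0 = 0 \<and> deriv H 0 = 1 \<and> deriv G 0 = 0"

definition sense_preserving :: "(complex \<Rightarrow> complex) \<Rightarrow> (complex \<Rightarrow> complex) \<Rightarrow> bool" where
  "sense_preserving h g \<longleftrightarrow>
     (\<forall>z\<in>unit_disc. (cmod (deriv h z))\<^sup>2 - (cmod (deriv g z))\<^sup>2 > 0)"

text \<open>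
  The decomposition \<open>f = h + cnj g\<close> is unique up to the additive constants of \<open>h\<close> and \<open>g\<close>, on
  which neither the sense-preserving property nor the univalence of \<open>h + \<mu> cnj g\<close> depends.
\<close>

definition SHU :: "(complex \<Rightarrow> complex) set" where
  "SHU = {f. \<exists>h g. h holomorphic_on unit_disc \<and> g holomorphic_on unit_disc \<and>
                (\<forall>z\<in>unit_disc. f z = harmonic_map h g z) \<and> sense_preserving h g \<and>
                (\<forall>\<mu>. cmod \<mu> = 1 \<longrightarrow> inj_on (\<lambda>z. h z + \<mu> * cnj (g z)) unit_disc)}"

text \<open>
  Both suprema below are real-valued; for a holomorphic \<open>w\<close> with \<open>cmod (w z) < 1\<close> the sets are
  bounded by \<open>1\<close> (for the second one, by the Schwarz--Pick lemma).
\<close>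

definition sup_norm :: "(complex \<Rightarrow> complex) \<Rightarrow> real" where
  "sup_norm w = (SUP z\<in>unit_disc. cmod (w z))"

definition hyperbolic_norm :: "(complex \<Rightarrow> complex) \<Rightarrow> real" where
  "hyperbolic_norm w =
     (SUP z\<in>unit_disc. cmod (deriv w z) * (1 - (cmod z)\<^sup>2) / (1 - (cmod (w z))\<^sup>2))"

end

theory Submission
  imports Defs
begin

text \<open>
  Stable harmonic univalence is reduced to analytic univalence: if \<open>H + \<epsilon> * G\<close> is injective for
  every unimodular \<open>\<epsilon>\<close>, then so is \<open>H + \<mu> * cnj G\<close> for every unimodular \<open>\<mu>\<close>
  (\<open>SHU_of_analytic_univalence\<close>). The functions \<open>f = H + \<epsilon> * G\<close> are handled by Becker's criterion
  \<open>(1 - (cmod z)\<^sup>2) * cmod (z * f'' z / f' z) \<le> 1\<close>, which is proved here by extending \<open>f\<close> across the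
  unit circle by the formula of Ahlfors and Weill. The extension is a proper local homeomorphism of
  the plane, and such maps are injective because the plane is simply connected.

  For a horizontal shear, \<open>f'' / f'\<close> is the sum of a term from the integral operator and a term
  from the dilatation \<open>\<alpha> * (1 + \<beta>) * w\<close>. The latter contributes at most
  \<open>2 * \<alpha> * (1 + \<beta>) * hyperbolic_norm w * (1 + sup_norm w) * cmod z\<close>, provided that
  \<open>\<alpha> * (1 + \<beta>) \<le> 1 / 2\<close>, which all the ranges of \<open>\<alpha>\<close> imply
  (\<open>horizontal_shear_univalent\<close>).

  The former is \<open>\<alpha>\<close> times \<open>\<zeta> * \<phi>' \<zeta> / \<phi> \<zeta> - 1 + \<beta> * \<zeta> / (1 - \<zeta>)\<close> at a rotated point \<open>\<zeta>\<close>.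
  The essential estimate is
  \<open>(1 - (cmod \<zeta>)\<^sup>2) * cmod (\<zeta> * \<phi>' \<zeta> / \<phi> \<zeta>) \<le> 2 * \<gamma>\<close> for univalent \<open>\<phi>\<close> in a linear invariant
  family of order \<open>\<gamma>\<close> (\<open>univalent_logarithmic_derivative_bound\<close>). It follows from the Schwarz
  lemma, applied to the inverse of \<open>\<phi>\<close>, and a Koebe-type covering theorem
  (\<open>univalent_image_contains_ball\<close>): the order of the family bounds the pre-Schwarzian derivative of
  \<open>\<phi>\<close>, which makes \<open>(1 - (cmod z)\<^sup>2) * cmod (\<phi>' z)\<close>, as a function of \<open>\<phi> z\<close>, Lipschitz with
  constant \<open>2 * \<gamma>\<close> along segments in the image.

  Altogether, with \<open>r = cmod z\<close> and
  \<open>B = \<beta> + 2 * (1 + \<beta>) * hyperbolic_norm w * (1 + sup_norm w)\<close>, Becker's criterion holds as soon as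
  \<open>\<alpha> * (2 * \<gamma> + 1 + B * r - (1 - \<beta>) * r\<^sup>2) \<le> 1\<close>. The three cases of the theorem
  correspond to the place where this quadratic in \<open>r\<close> is largest: at the endpoint \<open>r = 1\<close> or, if
  \<open>\<beta> < 1\<close> and \<open>B \<le> 2 * (1 - \<beta>)\<close>, at its vertex.
\<close>

section \<open>Proper local homeomorphisms\<close>

text \<open>
  Properness makes the fibres finite and lets one shrink neighbourhoods of their points to a
  common evenly covered neighbourhood of the value, so \<open>F\<close> is a covering of the simply connected
  space by itself. If \<open>F a = F b\<close>, the image of the segment from \<open>a\<close> to \<open>b\<close> is a loop, hence
  contractible, and by monodromy its lift closes up: \<open>a = b\<close>.
\<close>

lemma proper_locally_injective_imp_inj:
  fixes F :: "'a::euclidean_space \<Rightarrow> 'a"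
  assumes cont: "continuous_on UNIV F"
    and loc: "\<And>x. \<exists>U. open U \<and> x \<in> U \<and> inj_on F U"
    and proper: "\<And>K. compact K \<Longrightarrow> compact (F -` K)"
  shows "inj F"
proof -
  have opn: "open (F ` W)" if "open W" for W
  proof (subst open_subopen, clarify)
    fix x assume "x \<in> W"
    obtain U where U: "open U" "x \<in> U" "inj_on F U" using loc by blast
    have "open (F ` (U \<inter> W))"
      using U \<open>open W\<close> cont by (intro invariance_of_domain) (auto intro: continuous_on_subset inj_on_subset)
    then show "\<exists>T. open T \<and> F x \<in> T \<and> T \<subseteq> F ` W"
      using U \<open>x \<in> W\<close> by blast
  qed
  have cls: "closed (F ` C)" if "closed C" for C
    using proper_map[where S=UNIV and K=C and T=UNIV and f=F] that proper by auto
  have surj: "range F = UNIV"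
    using clopen[of "range F"] opn[of UNIV] cls[of UNIV] by auto
  have cov: "covering_space UNIV F UNIV"
  proof
    fix y :: 'a
    define K where "K = F -` {y}"
    obtain U where U: "\<And>x. open (U x)" "\<And>x. x \<in> U x" "\<And>x. inj_on F (U x)"
      using loc by metis
    have "compact K" unfolding K_def by (intro proper) auto
    then obtain D where D: "D \<subseteq> K" "finite D" "K \<subseteq> (\<Union>x\<in>D. U x)"
      using U by (elim compactE_image[where C=K and f=U]) auto
    have "K \<subseteq> D"
    proof
      fix z assume "z \<in> K"
      then obtain x where x: "x \<in> D" "z \<in> U x" using D by auto
      then have "F x = F z" using D \<open>z \<in> K\<close> by (auto simp: K_def)
      then show "z \<in> D" using U(2,3)[of x] x by (auto dest: inj_onD)
    qed
    then have "finite K" using D finite_subset by blast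
    have "K \<noteq> {}" using surj unfolding K_def by (metis UNIV_I empty_iff f_inv_into_f vimage_singleton_eq)
    have "\<forall>x\<in>K. \<exists>d>0. ball x d \<subseteq> U x \<and> (\<forall>x'\<in>K. x' \<noteq> x \<longrightarrow> 2 * d \<le> dist x x')"
    proof
      fix x assume "x \<in> K"
      obtain e where e: "e > 0" "ball x e \<subseteq> U x" using U openE by metis
      obtain d where d: "d > 0" "\<forall>x'\<in>K. x' \<noteq> x \<longrightarrow> d \<le> dist x x'"
        using finite_set_avoid[OF \<open>finite K\<close>] by blast
      show "\<exists>d>0. ball x d \<subseteq> U x \<and> (\<forall>x'\<in>K. x' \<noteq> x \<longrightarrow> 2 * d \<le> dist x x')"
        using e d by (intro exI[of _ "min e (d/2)"]) (auto simp: min_def)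
    qed
    then obtain d where d: "\<And>x. x \<in> K \<Longrightarrow> d x > 0" "\<And>x. x \<in> K \<Longrightarrow> ball x (d x) \<subseteq> U x"
        "\<And>x x'. x \<in> K \<Longrightarrow> x' \<in> K \<Longrightarrow> x' \<noteq> x \<Longrightarrow> 2 * d x \<le> dist x x'"
      by metis
    define N where "N x = ball x (d x)" for x
    have disj: "N x \<inter> N x' = {}" if "x \<in> K" "x' \<in> K" "x \<noteq> x'" for x x'
    proof -
      have "2 * d x \<le> dist x x'" "2 * d x' \<le> dist x x'"
        using d(3)[of x x'] d(3)[of x' x] that by (auto simp: dist_commute)
      then show ?thesis
        unfolding N_def by (intro disjoint_ballI) auto
    qed
    have injN: "inj_on F (N x)" if "x \<in> K" for x
      using U(3) d(2)[OF that] unfolding N_def by (rule inj_on_subset)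
    \<comment> \<open>The evenly covered neighbourhood: removing the closed image of the complement of the balls
      leaves no preimage outside them.\<close>
    define W where "W = (\<Inter>x\<in>K. F ` N x) - F ` (UNIV - (\<Union>x\<in>K. N x))"
    have "closed (UNIV - (\<Union>x\<in>K. N x))" by (auto simp: N_def closed_def)
    then have "open W" unfolding W_def
      using \<open>finite K\<close> by (intro open_Diff open_INT cls ballI opn) (auto simp: N_def)
    have "y \<in> W"
      unfolding W_def
    proof
      show "y \<in> (\<Inter>x\<in>K. F ` N x)" using d(1) by (force simp: K_def N_def)
      show "y \<notin> F ` (UNIV - (\<Union>x\<in>K. N x))" using d(1) by (auto simp: K_def N_def)
    qed
    let ?v = "(\<lambda>x. N x \<inter> F -` W) ` K"
    have preW: "open (F -` W)" using cont \<open>open W\<close> by (simp add: continuous_on_open_vimage)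
    show "\<exists>T. y \<in> T \<and> openin (top_of_set UNIV) T \<and>
             (\<exists>v. \<Union>v = UNIV \<inter> F -` T \<and> (\<forall>u \<in> v. openin (top_of_set UNIV) u) \<and>
                pairwise disjnt v \<and> (\<forall>u \<in> v. \<exists>q. homeomorphism u T F q))"
    proof (intro exI conjI)
      show "y \<in> W" by fact
      show "openin (top_of_set UNIV) W" using \<open>open W\<close> by simp
      show "\<Union>?v = UNIV \<inter> F -` W" by (auto simp: W_def)
      show "\<forall>u\<in>?v. openin (top_of_set UNIV) u" using preW by (auto simp: N_def)
      show "pairwise disjnt ?v"
        unfolding pairwise_def disjnt_def using disj by blast
      show "\<forall>u\<in>?v. \<exists>q. homeomorphism u W F q"
      proof clarify
        fix x assume "x \<in> K"
        have "W \<subseteq> F ` N x" using \<open>x \<in> K\<close> by (auto simp: W_def)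
        then have "F ` (N x \<inter> F -` W) = W" by blast
        moreover have "inj_on F (N x \<inter> F -` W)" using injN[OF \<open>x \<in> K\<close>] by (rule inj_on_subset) auto
        moreover have "open (N x \<inter> F -` W)" using preW by (auto simp: N_def)
        ultimately show "\<exists>q. homeomorphism (N x \<inter> F -` W) W F q"
          using invariance_of_domain_homeomorphism[of "N x \<inter> F -` W" F] cont
          by (metis continuous_on_subset order_refl subset_UNIV)
      qed
    qed
  qed (use cont surj in auto)
  show "inj F"
  proof (rule injI)
    fix a b assume ab: "F a = F b"
    let ?h = "linepath a b"
    have 1: "path (F \<circ> ?h)" using cont by (intro path_continuous_image) (auto intro: continuous_on_subset)
    have "homotopic_paths UNIV (F \<circ> ?h) (linepath (F a) (F a))"
      using 1 ab convex_imp_simply_connected[of "UNIV::'a set"]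
      unfolding simply_connected_eq_contractible_path
      by (auto simp: pathstart_compose pathfinish_compose)
    from covering_space_monodromy[OF cov 1 _ _ _ this, of ?h "linepath a a"]
    show "a = b" by simp
  qed
qed

section \<open>Becker's univalence criterion\<close>

text \<open>
  The coefficients \<open>A\<close> and \<open>B\<close> are the Wirtinger derivatives of \<open>F\<close>. The linear map
  \<open>A z0 * h + B z0 * cnj h\<close> stretches every vector by at least \<open>cmod (A z0) - cmod (B z0)\<close>, and
  near \<open>z0\<close> the difference between \<open>F\<close> and this map has a smaller Lipschitz constant.
\<close>

lemma wirtinger_locally_injective:
  fixes F A B :: "complex \<Rightarrow> complex"
  assumes der: "\<And>z. (F has_derivative (\<lambda>h. A z * h + B z * cnj h)) (at z)"
    and cont: "isCont A z0" "isCont B z0"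
    and less: "cmod (B z0) < cmod (A z0)"
  shows "\<exists>U. open U \<and> z0 \<in> U \<and> inj_on F U"
proof -
  define \<epsilon> where "\<epsilon> = (cmod (A z0) - cmod (B z0)) / 3"
  have "\<epsilon> > 0" using less by (simp add: \<epsilon>_def)
  obtain d1 where d1: "d1 > 0" "\<And>z. dist z z0 < d1 \<Longrightarrow> dist (A z) (A z0) < \<epsilon>"
    using cont(1) \<open>\<epsilon> > 0\<close> unfolding continuous_at_eps_delta by blast
  obtain d2 where d2: "d2 > 0" "\<And>z. dist z z0 < d2 \<Longrightarrow> dist (B z) (B z0) < \<epsilon>"
    using cont(2) \<open>\<epsilon> > 0\<close> unfolding continuous_at_eps_delta by blast
  define U where "U = ball z0 (min d1 d2)"
  define g where "g z = F z - (A z0 * z + B z0 * cnj z)" for z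
  have g: "(g has_derivative (\<lambda>h. (A z - A z0) * h + (B z - B z0) * cnj h)) (at z within U)" for z
    unfolding g_def
    by (rule derivative_eq_intros has_derivative_at_withinI[OF der] refl | simp)+
       (simp add: algebra_simps)
  have onorm: "onorm (\<lambda>h. (A z - A z0) * h + (B z - B z0) * cnj h) \<le> 2 * \<epsilon>" if "z \<in> U" for z
  proof (rule onorm_le)
    fix h
    have "cmod (A z - A z0) \<le> \<epsilon>" "cmod (B z - B z0) \<le> \<epsilon>"
      using that d1(2)[of z] d2(2)[of z] by (auto simp: U_def dist_norm norm_minus_commute)
    then have "cmod (A z - A z0) * cmod h + cmod (B z - B z0) * cmod h \<le> \<epsilon> * cmod h + \<epsilon> * cmod h"
      by (intro add_mono mult_right_mono) auto
    moreover have "cmod ((A z - A z0) * h + (B z - B z0) * cnj h)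
        \<le> cmod (A z - A z0) * cmod h + cmod (B z - B z0) * cmod h"
      by (rule order_trans[OF norm_triangle_ineq]) (simp add: norm_mult)
    ultimately show "cmod ((A z - A z0) * h + (B z - B z0) * cnj h) \<le> 2 * \<epsilon> * cmod h" by simp
  qed
  have "inj_on F U"
  proof (rule inj_onI)
    fix x y assume xy: "x \<in> U" "y \<in> U" "F x = F y"
    have "cmod (g x - g y) \<le> 2 * \<epsilon> * cmod (x - y)"
      by (rule differentiable_bound[of U, OF _ g onorm]) (use xy in \<open>auto simp: U_def\<close>)
    also have "g x - g y = - (A z0 * (x - y) + B z0 * cnj (x - y))"
      using xy by (simp add: g_def algebra_simps)
    finally have "cmod (A z0 * (x - y) + B z0 * cnj (x - y)) \<le> 2 * \<epsilon> * cmod (x - y)"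
      by (simp only: norm_minus_cancel)
    moreover have "cmod (A z0) * cmod (x - y) - cmod (B z0) * cmod (x - y)
        \<le> cmod (A z0 * (x - y) + B z0 * cnj (x - y))"
      using norm_diff_ineq[of "A z0 * (x - y)" "B z0 * cnj (x - y)"]
      by (simp only: norm_mult complex_mod_cnj)
    ultimately have "(cmod (A z0) - cmod (B z0)) * cmod (x - y) \<le> 2 * \<epsilon> * cmod (x - y)"
      unfolding left_diff_distrib by linarith
    then have "\<epsilon> * cmod (x - y) \<le> 0" by (simp add: \<epsilon>_def field_simps)
    then show "x = y" using \<open>\<epsilon> > 0\<close> by (simp add: mult_le_0_iff)
  qed
  then show ?thesis using d1 d2 by (intro exI[of _ U]) (auto simp: U_def)
qed

lemma has_derivative_within_Un:
  assumes "(f has_derivative D) (at x within S)" "(f has_derivative D) (at x within T)"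
  shows "(f has_derivative D) (at x within (S \<union> T))"
  using assms unfolding has_derivative_within by (auto intro: Lim_Un)

text \<open>
  The Ahlfors--Weill extension \<open>F\<close> of \<open>f\<close> is \<open>f v + (z - v) * f' v\<close> outside the disc, where
  \<open>v = 1 / cnj z\<close> is the reflection of \<open>z\<close>. Its Wirtinger derivatives there are \<open>f' v\<close> and
  \<open>- v\<^sup>2 * (z - v) * f'' v\<close>; since \<open>cmod (v * (z - v)) = 1 - (cmod v)\<^sup>2\<close>, the assumed inequality
  says exactly that the first one dominates. On the unit circle both pieces have the derivative
  \<open>f'\<close>, so \<open>F\<close> is continuously differentiable on the plane, locally injective, and of linear
  growth at infinity. Being proper, it is injective.
\<close>

lemma Ahlfors_Weill_injective:
  fixes f f' f'' :: "complex \<Rightarrow> complex"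
  assumes "R > 1"
    and f: "\<And>z. z \<in> ball 0 R \<Longrightarrow> (f has_field_derivative f' z) (at z)"
    and f': "\<And>z. z \<in> ball 0 R \<Longrightarrow> (f' has_field_derivative f'' z) (at z)"
    and f'': "continuous_on (ball 0 R) f''"
    and nz: "\<And>z. z \<in> cball 0 1 \<Longrightarrow> f' z \<noteq> 0"
    and bound: "\<And>z. z \<in> cball 0 1 \<Longrightarrow> (1 - (cmod z)\<^sup>2) * cmod (z * f'' z) < cmod (f' z)"
  shows "inj_on f (cball 0 1)"
proof -
  \<comment> \<open>\<open>E\<close> is the exterior piece of the extension, \<open>A\<close> and \<open>B\<close> are the Wirtinger derivatives of \<open>F\<close>.\<close>
  define v where "v z = inverse (cnj z)" for z :: complex
  define E where "E z = f (v z) + (z - v z) * f' (v z)" for z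
  define b where "b z = - ((v z)\<^sup>2 * (z - v z) * f'' (v z))" for z
  define F where "F z = (if cmod z \<le> 1 then f z else E z)" for z
  define A where "A z = (if cmod z \<le> 1 then f' z else f' (v z))" for z
  define B where "B z = (if cmod z \<le> 1 then 0 else b z)" for z
  have cball: "z \<in> ball 0 R" if "cmod z \<le> 1" for z using that \<open>R > 1\<close> by simp
  have v1: "v z = z" if "cmod z = 1" for z
  proof -
    have "cnj z * z = 1" using complex_norm_square[of z] that by (simp add: mult.commute)
    then show ?thesis unfolding v_def by (rule inverse_unique)
  qed
  have vle: "cmod (v z) \<le> 1" if "cmod z \<ge> 1" for z
    using that by (simp add: v_def norm_inverse inverse_le_1_iff)
  have vder: "(v has_derivative (\<lambda>h. - (v z)\<^sup>2 * cnj h)) (at z)" if "z \<noteq> 0" for z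
    unfolding v_def using that
    by (auto intro!: derivative_eq_intros simp: power2_eq_square)
  have Eder: "(E has_derivative (\<lambda>h. f' (v z) * h + b z * cnj h)) (at z)" if "cmod z \<ge> 1" for z
  proof -
    have z: "z \<noteq> 0" "v z \<in> ball 0 R" using that vle cball by auto
    have 1: "((\<lambda>z. f (v z)) has_derivative (\<lambda>h. f' (v z) * (- (v z)\<^sup>2 * cnj h))) (at z)"
      using has_derivative_compose[OF vder[OF z(1)] f[OF z(2), unfolded has_field_derivative_def]] .
    have 2: "((\<lambda>z. f' (v z)) has_derivative (\<lambda>h. f'' (v z) * (- (v z)\<^sup>2 * cnj h))) (at z)"
      using has_derivative_compose[OF vder[OF z(1)] f'[OF z(2), unfolded has_field_derivative_def]] .
    show ?thesis unfolding E_def b_def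
      by (rule derivative_eq_intros 1 2 vder[OF z(1)] refl)+ (simp add: algebra_simps)
  qed
  have fder: "(f has_derivative (\<lambda>h. f' z * h + 0 * cnj h)) (at z)" if "cmod z \<le> 1" for z
    using f[OF cball[OF that]] by (simp add: has_field_derivative_def)
  have E1: "E z = f z" "b z = 0" if "cmod z = 1" for z
    using v1[OF that] by (auto simp: E_def b_def)
  have Fder: "(F has_derivative (\<lambda>h. A z * h + B z * cnj h)) (at z)" for z
  proof -
    consider "cmod z < 1" | "cmod z > 1" | "cmod z = 1" by linarith
    then show ?thesis
    proof cases
      case 1
      show ?thesis
        by (rule has_derivative_transform_within_open[of f _ z UNIV "ball 0 1"])
           (use 1 fder[of z] in \<open>auto simp: F_def A_def B_def\<close>)
    next
      case 2
      show ?thesis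
        by (rule has_derivative_transform_within_open[of E _ z UNIV "- cball 0 1"])
           (use 2 Eder[of z] in \<open>auto simp: F_def A_def B_def\<close>)
    next
      case 3
      have AB: "A z = f' z" "B z = 0" "b z = 0" "f' (v z) = f' z"
        using 3 v1[OF 3] E1[OF 3] by (auto simp: A_def B_def)
      have "(F has_derivative (\<lambda>h. A z * h + B z * cnj h)) (at z within cball 0 1)"
        by (rule has_derivative_transform[where f=f])
           (use 3 has_derivative_at_withinI[OF fder[of z], of "cball 0 1"] AB in \<open>auto simp: F_def\<close>)
      moreover have "(F has_derivative (\<lambda>h. A z * h + B z * cnj h)) (at z within - ball 0 1)"
        by (rule has_derivative_transform[where f=E])
           (use 3 has_derivative_at_withinI[OF Eder[of z], of "- ball 0 1"] AB E1 in \<open>auto simp: F_def\<close>)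
      moreover have "cball 0 1 \<union> - ball 0 1 = (UNIV :: complex set)" by auto
      ultimately show ?thesis using has_derivative_within_Un by metis
    qed
  qed
  have cv: "continuous_on (- ball 0 1) v"
    unfolding v_def by (intro continuous_intros) auto
  have vim: "v ` (- ball 0 1) \<subseteq> ball 0 R" using vle cball by auto
  have cf: "continuous_on (ball 0 R) f" and cf': "continuous_on (ball 0 R) f'"
    using f f' by (meson DERIV_isCont continuous_at_imp_continuous_on)+
  have cf'v: "continuous_on (- ball 0 1) (\<lambda>z. f' (v z))" and cf''v: "continuous_on (- ball 0 1) (\<lambda>z. f'' (v z))"
    using continuous_on_compose2[OF cf' cv vim] continuous_on_compose2[OF f'' cv vim] by blast+
  have cA: "continuous_on UNIV A"
  proof -
    have "continuous_on (cball 0 1 \<union> - ball 0 1) (\<lambda>z. if cmod z \<le> 1 then f' z else f' (v z))"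
      by (rule continuous_on_cases)
         (use v1 cball in \<open>auto intro: continuous_on_subset[OF cf'] intro!: cf'v\<close>)
    then show ?thesis by (auto simp: A_def[abs_def] elim: continuous_on_subset)
  qed
  have cB: "continuous_on UNIV B"
  proof -
    have "continuous_on (- ball 0 1) b"
      unfolding b_def
      by (intro continuous_on_minus continuous_on_mult continuous_on_power continuous_on_diff
            continuous_on_id cv cf''v)
    then have "continuous_on (cball 0 1 \<union> - ball 0 1) (\<lambda>z. if cmod z \<le> 1 then 0 else b z)"
      by (intro continuous_on_cases) (use E1 in auto)
    then show ?thesis by (auto simp: B_def[abs_def] elim: continuous_on_subset)
  qed
  have AB: "cmod (B z) < cmod (A z)" for z
  proof (cases "cmod z \<le> 1")
    case True
    then show ?thesis using nz[of z] by (simp add: A_def B_def)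
  next
    case False
    then have z: "z \<noteq> 0" "cmod z \<ge> 1" by auto
    have "cmod (v z * (z - v z)) = 1 - (cmod (v z))\<^sup>2"
    proof -
      have "cnj (v z) * (z - v z) = of_real (1 - (cmod (v z))\<^sup>2)"
      proof -
        have "cnj (v z) * z = 1" using z by (simp add: v_def)
        moreover have "cnj (v z) * v z = of_real ((cmod (v z))\<^sup>2)"
          using complex_norm_square[of "v z"] by (simp only: mult.commute)
        ultimately show ?thesis by (simp only: right_diff_distrib of_real_diff of_real_1)
      qed
      then have "cmod (cnj (v z) * (z - v z)) = \<bar>1 - (cmod (v z))\<^sup>2\<bar>" by (simp only: norm_of_real)
      moreover have "(cmod (v z))\<^sup>2 \<le> 1" using vle[OF z(2)] by (simp add: power_le_one)
      ultimately show ?thesis by (simp add: norm_mult)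
    qed
    then have "cmod (b z) = (1 - (cmod (v z))\<^sup>2) * cmod (v z * f'' (v z))"
      by (simp add: b_def norm_mult power2_eq_square mult_ac)
    then show ?thesis using False bound[of "v z"] vle[OF z(2)] by (simp add: A_def B_def)
  qed
  have isCont_F: "isCont F z" for z
    by (rule has_derivative_continuous[OF Fder])
  then have cF: "continuous_on UNIV F"
    by (simp add: continuous_at_imp_continuous_on)
  have "inj F"
  proof (rule proper_locally_injective_imp_inj[OF cF])
    fix z
    show "\<exists>U. open U \<and> z \<in> U \<and> inj_on F U"
      by (rule wirtinger_locally_injective[OF Fder _ _ AB])
         (use cA cB in \<open>auto simp: continuous_on_eq_continuous_at\<close>)
  next
    fix K :: "complex set" assume "compact K"
    have "closed (F -` K)"
      using isCont_F \<open>compact K\<close> by (intro continuous_closed_vimage compact_imp_closed)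
    have sub: "cball 0 1 \<subseteq> ball (0::complex) R" using \<open>R > 1\<close> by auto
    have c: "continuous_on (cball 0 1) f'" "continuous_on (cball 0 1) f"
      using sub cf cf' by (auto intro: continuous_on_subset)
    obtain m where m: "m > 0" "\<And>z. z \<in> cball 0 1 \<Longrightarrow> m \<le> cmod (f' z)"
    proof -
      have "\<exists>x\<in>cball 0 1. \<forall>y\<in>cball 0 1. cmod (f' x) \<le> cmod (f' y)"
        by (rule continuous_attains_inf) (auto intro!: continuous_intros c)
      then show ?thesis using that nz by (metis zero_less_norm_iff)
    qed
    have "bounded (f ` cball 0 1)" "bounded (f' ` cball 0 1)"
      using c by (simp_all add: compact_imp_bounded compact_continuous_image)
    then obtain M1 M2 where M: "\<And>z. z \<in> cball 0 1 \<Longrightarrow> cmod (f z) \<le> M1" "\<And>z. z \<in> cball 0 1 \<Longrightarrow> cmod (f' z) \<le> M2"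
      unfolding bounded_iff by (metis imageI)
    obtain k where k: "\<And>y. y \<in> K \<Longrightarrow> cmod y \<le> k"
      using \<open>compact K\<close> compact_imp_bounded bounded_iff by metis
    have "cmod z \<le> max 1 ((k + M1 + M2) / m)" if "F z \<in> K" for z
    proof (cases "cmod z \<le> 1")
      case False
      then have v: "v z \<in> cball 0 1" using vle[of z] by auto
      have "m * cmod z \<le> cmod (f' (v z)) * cmod z" using m(2)[OF v] by (intro mult_right_mono) auto
      also have "\<dots> = cmod (F z - f (v z) + v z * f' (v z))"
        using False by (simp add: F_def E_def algebra_simps flip: norm_mult)
      also have "\<dots> \<le> cmod (F z) + cmod (f (v z)) + cmod (v z * f' (v z))"
        by (meson add_mono norm_triangle_ineq norm_triangle_ineq4 order_refl order_trans)
      also have "cmod (v z * f' (v z)) \<le> 1 * M2"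
        unfolding norm_mult using v M(2)[OF v] by (intro mult_mono) auto
      finally have "m * cmod z \<le> k + M1 + M2" using k[OF that] M(1)[OF v] by linarith
      then have "cmod z \<le> (k + M1 + M2) / m" using m(1) by (simp add: field_simps)
      then show ?thesis by simp
    qed auto
    then have "bounded (F -` K)" unfolding bounded_iff by blast
    then show "compact (F -` K)" using \<open>closed (F -` K)\<close> compact_eq_bounded_closed by blast
  qed
  then have "inj_on F (cball 0 1)" by (rule inj_on_subset) simp
  moreover have "F z = f z" if "z \<in> cball 0 1" for z using that by (simp add: F_def)
  ultimately show ?thesis using inj_on_cong by blast
qed

text \<open>
  The dilation \<open>f (r * z)\<close> with \<open>r < 1\<close> is holomorphic beyond the closed disc and turns the weak
  inequality into a strict one, because \<open>1 - (cmod z)\<^sup>2 < 1 - (cmod (r * z))\<^sup>2\<close> for \<open>z \<noteq> 0\<close>; at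
  \<open>z = 0\<close> the left-hand side vanishes.
\<close>

theorem Becker_univalence_criterion:
  assumes holf: "f holomorphic_on unit_disc"
    and nz: "\<And>z. z \<in> unit_disc \<Longrightarrow> deriv f z \<noteq> 0"
    and bound: "\<And>z. z \<in> unit_disc \<Longrightarrow>
       (1 - (cmod z)\<^sup>2) * cmod (z * deriv (deriv f) z) \<le> cmod (deriv f z)"
  shows "inj_on f unit_disc"
proof (rule inj_onI)
  fix x y assume xy: "x \<in> unit_disc" "y \<in> unit_disc" "f x = f y"
  define r where "r = (1 + max (cmod x) (cmod y)) / 2"
  have r: "0 < r" "r < 1" "cmod x < r" "cmod y < r" 
    using xy by (auto simp: r_def max_def add_pos_nonneg)
  have in_disc: "of_real r * z \<in> unit_disc" if "z \<in> ball 0 (1 / r)" for z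
    using that r by (simp add: norm_mult field_simps)
  have der: "(f has_field_derivative deriv f z) (at z)" "(deriv f has_field_derivative deriv (deriv f) z) (at z)"
    if "z \<in> unit_disc" for z
    using that holf by (auto intro!: holomorphic_derivI holomorphic_deriv)
  have chain: "((\<lambda>z. g (of_real r * z)) has_field_derivative of_real r * d) (at z)"
    if "(g has_field_derivative d) (at (of_real r * z))" for g :: "complex \<Rightarrow> complex" and d z
  proof -
    have 1: "((\<lambda>z. of_real r * z) has_field_derivative of_real r) (at z)"
      by (rule DERIV_cmult_Id)
    show ?thesis
      using DERIV_chain2[where f=g and g="\<lambda>z. of_real r * z" and x=z, OF that 1]
      by (simp only: mult.commute[of d])
  qed
  have "inj_on (\<lambda>z. f (of_real r * z)) (cball 0 1)"
  proof (rule Ahlfors_Weill_injective[where R="1/r" and f'="\<lambda>z. of_real r * deriv f (of_real r * z)"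
        and f''="\<lambda>z. (of_real r)\<^sup>2 * deriv (deriv f) (of_real r * z)"])
    show "1 / r > 1" using r by simp
    show "((\<lambda>z. f (of_real r * z)) has_field_derivative of_real r * deriv f (of_real r * z)) (at z)"
      if "z \<in> ball 0 (1/r)" for z
      using chain[OF der(1)[OF in_disc[OF that]]] .
    show "((\<lambda>z. of_real r * deriv f (of_real r * z)) has_field_derivative (of_real r)\<^sup>2 * deriv (deriv f) (of_real r * z)) (at z)"
      if "z \<in> ball 0 (1/r)" for z
      using DERIV_cmult[OF chain[OF der(2)[OF in_disc[OF that]]], of "of_real r"]
      by (simp add: mult.assoc power2_eq_square)
    have c: "continuous_on unit_disc (deriv (deriv f))"
      using holf by (intro holomorphic_on_imp_continuous_on holomorphic_deriv) auto
    then show "continuous_on (ball 0 (1/r)) (\<lambda>z. (of_real r)\<^sup>2 * deriv (deriv f) (of_real r * z))"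
      using in_disc by (intro continuous_on_mult_left continuous_on_compose2[OF c])
        (auto intro!: continuous_intros)
    fix z :: complex assume z: "z \<in> cball 0 1"
    have rz: "of_real r * z \<in> unit_disc"
    proof -
      have "r * cmod z \<le> r * 1" using z r by (intro mult_left_mono) auto
      also have "\<dots> < 1" using r by simp
      finally have "cmod (of_real r * z) < 1" using r by (simp add: norm_mult del: mult_le_cancel_left1)
      then show ?thesis by simp
    qed
    show "of_real r * deriv f (of_real r * z) \<noteq> 0" using nz[OF rz] r by simp
    let ?q = "cmod (of_real r * z * deriv (deriv f) (of_real r * z))"
    have b: "(1 - (r * cmod z)\<^sup>2) * ?q \<le> cmod (deriv f (of_real r * z))"
      using bound[OF rz] r by (simp add: norm_mult)
    have "(1 - (cmod z)\<^sup>2) * ?q < cmod (deriv f (of_real r * z))"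
    proof (cases "?q = 0")
      case True
      have "0 < cmod (deriv f (of_real r * z))" using nz[OF rz] by (simp only: zero_less_norm_iff not_False_eq_True)
      then show ?thesis unfolding True by (simp only: mult_zero_right)
    next
      case False
      then have "z \<noteq> 0" by auto
      then have "(r * cmod z)\<^sup>2 < (cmod z)\<^sup>2" using r by (intro power_strict_mono) auto
      then have "(1 - (cmod z)\<^sup>2) * ?q < (1 - (r * cmod z)\<^sup>2) * ?q"
      proof (intro mult_strict_right_mono diff_strict_left_mono)
        show "0 < ?q" using False norm_ge_zero by (metis less_eq_real_def)
      qed
      then show ?thesis using b by linarith
    qed
    then have "r * ((1 - (cmod z)\<^sup>2) * ?q) < r * cmod (deriv f (of_real r * z))"
      using r by (intro mult_strict_left_mono)
    then show "(1 - (cmod z)\<^sup>2) * cmod (z * ((of_real r)\<^sup>2 * deriv (deriv f) (of_real r * z)))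
       < cmod (of_real r * deriv f (of_real r * z))"
      using r by (simp add: norm_mult power2_eq_square mult_ac)
  qed
  moreover have "f (of_real r * (x / of_real r)) = f (of_real r * (y / of_real r))" using xy r by simp
  moreover have "x / of_real r \<in> cball 0 1" "y / of_real r \<in> cball 0 1"
    using r by (auto simp: norm_divide)
  ultimately have "x / of_real r = y / of_real r" by (rule inj_onD)
  then show "x = y" using r by simp
qed

section \<open>Schwarz--Pick and the hyperbolic derivative\<close>

lemma has_field_derivative_Moebius:
  assumes "cmod w < 1" "cmod z < 1"
  shows "(Moebius_function 0 w has_field_derivative of_real (1 - (cmod w)\<^sup>2) / (1 - cnj w * z)\<^sup>2) (at z)"
proof -
  have "cmod (cnj w * z) < 1" using assms norm_mult_less[of "cnj w" 1 z 1] by simp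
  then have nz: "1 - cnj w * z \<noteq> 0" by auto
  have w: "(of_real (cmod w))\<^sup>2 = w * cnj w" using complex_norm_square[of w] by simp
  show ?thesis
    unfolding Moebius_function_simple[abs_def]
    by (rule derivative_eq_intros refl nz | simp)+
       (use nz in \<open>simp add: w[unfolded power2_eq_square] power2_eq_square algebra_simps\<close>)
qed

text \<open>
  Conjugating with disc automorphisms that move \<open>a\<close> and \<open>f a\<close> to the origin reduces this to the
  bound on the derivative at \<open>0\<close> in the Schwarz lemma.
\<close>

lemma Schwarz_Pick_deriv:
  assumes hol: "f holomorphic_on unit_disc" and less1: "\<And>z. z \<in> unit_disc \<Longrightarrow> cmod (f z) < 1"
    and a: "a \<in> unit_disc"
  shows "cmod (deriv f a) * (1 - (cmod a)\<^sup>2) \<le> 1 - (cmod (f a))\<^sup>2"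
proof -
  define h where "h = Moebius_function 0 (f a) \<circ> f \<circ> Moebius_function 0 (- a)"
  have a1: "cmod a < 1" "cmod (f a) < 1" using a less1 by auto
  have M0: "Moebius_function 0 (- a) 0 = a" by (simp add: Moebius_function_simple)
  have h0: "h 0 = 0" by (simp add: h_def M0 Moebius_function_eq_zero)
  have "h holomorphic_on unit_disc"
    unfolding h_def
  proof (rule holomorphic_on_compose_gen[OF _ holomorphic_on_compose_gen[OF hol]])
    show "Moebius_function 0 (- a) holomorphic_on unit_disc"
      "Moebius_function 0 (f a) holomorphic_on unit_disc"
      using a1 by (simp_all add: Moebius_function_holomorphic)
    show "f ` unit_disc \<subseteq> unit_disc" using less1 by (intro image_subsetI) simp
    show "Moebius_function 0 (- a) ` unit_disc \<subseteq> unit_disc"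
      using a1 by (auto intro!: Moebius_function_norm_lt_1)
  qed
  moreover have "cmod (h z) < 1" if "cmod z < 1" for z
  proof -
    have "Moebius_function 0 (- a) z \<in> unit_disc"
      using that a1 by (simp add: Moebius_function_norm_lt_1)
    then show ?thesis
      using a1 less1 by (simp add: h_def Moebius_function_norm_lt_1)
  qed
  ultimately have "cmod (deriv h 0) \<le> 1"
    using Schwarz_Lemma(2)[of h 0] h0 by simp
  moreover have "(h has_field_derivative (of_real (1 - (cmod (f a))\<^sup>2) / (1 - cnj (f a) * f a)\<^sup>2) *
      (deriv f a * of_real (1 - (cmod a)\<^sup>2))) (at 0)"
  proof -
    have 1: "(Moebius_function 0 (- a) has_field_derivative of_real (1 - (cmod a)\<^sup>2)) (at 0)"
      using has_field_derivative_Moebius[of "- a" 0] a1 by simp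
    have 2: "(f has_field_derivative deriv f a) (at (Moebius_function 0 (- a) 0))"
      using hol a M0 by (simp add: holomorphic_derivI)
    have 3: "(Moebius_function 0 (f a) has_field_derivative
        (of_real (1 - (cmod (f a))\<^sup>2) / (1 - cnj (f a) * f a)\<^sup>2)) (at ((f \<circ> Moebius_function 0 (- a)) 0))"
      using has_field_derivative_Moebius[of "f a" "f a"] a1 M0 by simp
    show ?thesis unfolding h_def comp_assoc by (rule DERIV_chain[OF 3 DERIV_chain[OF 2 1]])
  qed
  then have "deriv h 0 = (of_real (1 - (cmod (f a))\<^sup>2) / (1 - cnj (f a) * f a)\<^sup>2) *
      (deriv f a * of_real (1 - (cmod a)\<^sup>2))"
    by (rule DERIV_imp_deriv)
  moreover have "1 - cnj (f a) * f a = of_real (1 - (cmod (f a))\<^sup>2)"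
    using complex_norm_square[of "f a"] by (simp add: mult.commute)
  moreover define A B where "A = 1 - (cmod a)\<^sup>2" and "B = 1 - (cmod (f a))\<^sup>2"
  ultimately have "cmod (of_real B / (of_real B)\<^sup>2 * (deriv f a * of_real A)) \<le> 1" by simp
  moreover have "A > 0" "B > 0" using a1 by (auto simp: A_def B_def power_less_one_iff)
  ultimately have "cmod (deriv f a) * A \<le> B"
    by (simp add: norm_mult norm_divide power2_eq_square field_simps)
  then show ?thesis by (simp add: A_def B_def)
qed

lemma sup_norm_upper:
  assumes "\<And>z. z \<in> unit_disc \<Longrightarrow> cmod (w z) < 1" "z \<in> unit_disc"
  shows "cmod (w z) \<le> sup_norm w"
  unfolding sup_norm_def
  by (rule cSUP_upper[OF assms(2)]) (use assms(1) in \<open>auto intro!: bdd_aboveI[of _ 1] less_imp_le\<close>)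

text \<open>
  Schwarz--Pick bounds the quotients by \<open>1\<close>, so the supremum in \<open>hyperbolic_norm\<close> is a genuine one.
\<close>

lemma hyperbolic_norm_upper:
  assumes "w holomorphic_on unit_disc" "\<And>z. z \<in> unit_disc \<Longrightarrow> cmod (w z) < 1" "z \<in> unit_disc"
  shows "cmod (deriv w z) * (1 - (cmod z)\<^sup>2) \<le> hyperbolic_norm w * (1 - (cmod (w z))\<^sup>2)"
proof -
  have pos: "1 - (cmod (w z))\<^sup>2 > 0" if "z \<in> unit_disc" for z
    using assms(2)[OF that] by (simp add: power_less_one_iff)
  have "bdd_above ((\<lambda>z. cmod (deriv w z) * (1 - (cmod z)\<^sup>2) / (1 - (cmod (w z))\<^sup>2)) ` unit_disc)"
  proof (rule bdd_aboveI2)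
    show "cmod (deriv w z) * (1 - (cmod z)\<^sup>2) / (1 - (cmod (w z))\<^sup>2) \<le> 1" if "z \<in> unit_disc" for z
      using Schwarz_Pick_deriv[OF assms(1,2) that] pos[OF that] by (simp only: pos_divide_le_eq mult_1)
  qed
  from cSUP_upper[OF assms(3) this]
  have "cmod (deriv w z) * (1 - (cmod z)\<^sup>2) / (1 - (cmod (w z))\<^sup>2) \<le> hyperbolic_norm w"
    by (simp add: hyperbolic_norm_def)
  then show ?thesis using pos[OF assms(3)] by (simp add: pos_divide_le_eq)
qed

lemma sup_norm_nonneg: "(\<And>z. z \<in> unit_disc \<Longrightarrow> cmod (w z) < 1) \<Longrightarrow> 0 \<le> sup_norm w"
  by (rule order_trans[OF norm_ge_zero sup_norm_upper[of w 0]]) auto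

lemma hyperbolic_norm_nonneg:
  assumes "w holomorphic_on unit_disc" "\<And>z. z \<in> unit_disc \<Longrightarrow> cmod (w z) < 1"
  shows "0 \<le> hyperbolic_norm w"
proof -
  have "0 \<le> cmod (deriv w 0) * (1 - (cmod 0)\<^sup>2)" by simp
  also have "\<dots> \<le> hyperbolic_norm w * (1 - (cmod (w 0))\<^sup>2)"
    by (rule hyperbolic_norm_upper[OF assms]) auto
  finally have "0 \<le> hyperbolic_norm w * (1 - (cmod (w 0))\<^sup>2)" .
  moreover have "0 < 1 - (cmod (w 0))\<^sup>2" using assms(2)[of 0] by (simp add: power_less_one_iff)
  ultimately show ?thesis by (simp only: zero_le_mult_iff) linarith
qed

section \<open>Univalent members of linear invariant families\<close>

lemma locally_univalent_deriv_nonzero: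
  assumes "f holomorphic_on unit_disc" "locally_univalent f" "z \<in> unit_disc"
  shows "deriv f z \<noteq> 0"
proof -
  obtain U where U: "open U" "z \<in> U" "U \<subseteq> unit_disc" "inj_on f U"
    using assms unfolding locally_univalent_def by blast
  then show ?thesis
    using assms holomorphic_injective_imp_regular[of f U z] holomorphic_on_subset by blast
qed

text \<open>
  The left-hand side is twice the second Taylor coefficient of the Koebe transform of \<open>\<phi>\<close> at
  \<open>a\<close>, which agrees on the disc with a member of the family.
\<close>

lemma linear_invariant_second_derivative_bound:
  assumes L: "linear_invariant_family L" "family_order L = ereal \<gamma>" "\<phi> \<in> L"
    and a: "a \<in> unit_disc"
  shows "cmod (of_real (1 - (cmod a)\<^sup>2) * (deriv (deriv \<phi>) a / deriv \<phi> a) - 2 * cnj a) \<le> 2 * \<gamma>"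
proof -
  have hol: "\<phi> holomorphic_on unit_disc" and lu: "locally_univalent \<phi>"
    using L(1,3) unfolding linear_invariant_family_def by auto
  have nz: "deriv \<phi> z \<noteq> 0" if "z \<in> unit_disc" for z
    using locally_univalent_deriv_nonzero[OF hol lu that] .
  obtain \<psi> where \<psi>: "\<psi> \<in> L" "\<And>z. z \<in> unit_disc \<Longrightarrow> \<psi> z = koebe_transform \<phi> a z"
    using L(1,3) a unfolding linear_invariant_family_def by blast
  let ?M = "Moebius_function 0 (- a)"
  have a1: "cmod a < 1" using a by simp
  have M: "?M z \<in> unit_disc" if "z \<in> unit_disc" for z
    using that a1 by (simp add: Moebius_function_norm_lt_1)
  have aut: "disc_automorphism a = ?M"
    by (auto simp: disc_automorphism_def Moebius_function_simple fun_eq_iff)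
  define A where "A = complex_of_real (1 - (cmod a)\<^sup>2)"
  have A: "A \<noteq> 0" using a1 by (simp add: A_def) (metis abs_square_eq_1 less_irrefl norm_ge_zero abs_of_nonneg of_real_1 of_real_eq_iff of_real_power right_minus_eq)
  have nza: "1 + cnj a * z \<noteq> 0" if "z \<in> unit_disc" for z
  proof -
    have "cmod (cnj a * z) < 1" using that a1 norm_mult_less[of "cnj a" 1 z 1] by simp
    then show ?thesis by (metis add_eq_0_iff2 norm_minus_cancel norm_one less_irrefl)
  qed
  have derM: "(?M has_field_derivative A / (1 + cnj a * z)\<^sup>2) (at z)" if "z \<in> unit_disc" for z
    using has_field_derivative_Moebius[of "- a" z] that a1 by (simp add: A_def)
  \<comment> \<open>The derivative of the Koebe transform; the factor \<open>A\<close> from the automorphism cancels.\<close>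
  define K where "K z = deriv \<phi> (?M z) / ((1 + cnj a * z)\<^sup>2 * deriv \<phi> a)" for z
  have d\<psi>: "deriv \<psi> z = K z" if z: "z \<in> unit_disc" for z
  proof -
    have "((\<lambda>z. \<phi> (?M z)) has_field_derivative deriv \<phi> (?M z) * (A / (1 + cnj a * z)\<^sup>2)) (at z)"
      using DERIV_chain[OF _ derM[OF z], of \<phi> "deriv \<phi> (?M z)"] hol M[OF z]
      by (simp add: holomorphic_derivI o_def)
    then have "((\<lambda>z. (\<phi> (?M z) - \<phi> a) / (A * deriv \<phi> a)) has_field_derivative
        (deriv \<phi> (?M z) * (A / (1 + cnj a * z)\<^sup>2) - 0) / (A * deriv \<phi> a)) (at z)"
      by (intro DERIV_cdivide DERIV_diff DERIV_const)
    moreover have "koebe_transform \<phi> a = (\<lambda>z. (\<phi> (?M z) - \<phi> a) / (A * deriv \<phi> a))"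
      by (simp add: fun_eq_iff koebe_transform_def aut A_def)
    moreover have "(deriv \<phi> (?M z) * (A / (1 + cnj a * z)\<^sup>2) - 0) / (A * deriv \<phi> a) = K z"
      using A by (simp add: K_def)
    ultimately have "(koebe_transform \<phi> a has_field_derivative K z) (at z)" by simp
    then have "(\<psi> has_field_derivative K z) (at z)"
      by (rule has_field_derivative_transform_within_open[where S=unit_disc]) (use z \<psi>(2) in auto)
    then show ?thesis by (rule DERIV_imp_deriv)
  qed
  have "deriv (deriv \<psi>) 0 = A * (deriv (deriv \<phi>) a / deriv \<phi> a) - 2 * cnj a"
  proof -
    have M0: "?M 0 = a" by (simp add: Moebius_function_simple)
    have d\<phi>: "(deriv \<phi> has_field_derivative deriv (deriv \<phi>) a) (at (?M 0))"
      unfolding M0 using a hol by (intro holomorphic_derivI[of _ unit_disc] holomorphic_deriv) auto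
    have 1: "((\<lambda>z. deriv \<phi> (?M z)) has_field_derivative deriv (deriv \<phi>) a * A) (at 0)"
      using DERIV_chain[OF d\<phi> derM[of 0]] by (simp add: o_def)
    have 2: "((\<lambda>z. (1 + cnj a * z)\<^sup>2 * deriv \<phi> a) has_field_derivative 2 * cnj a * deriv \<phi> a) (at 0)"
      by (rule derivative_eq_intros refl | simp)+
    have "(K has_field_derivative (deriv (deriv \<phi>) a * A * ((1 + cnj a * 0)\<^sup>2 * deriv \<phi> a) -
        deriv \<phi> (?M 0) * (2 * cnj a * deriv \<phi> a)) /
        (((1 + cnj a * 0)\<^sup>2 * deriv \<phi> a) * ((1 + cnj a * 0)\<^sup>2 * deriv \<phi> a))) (at 0)"
      unfolding K_def[abs_def] by (rule DERIV_divide[OF 1 2]) (use nz[OF a] in simp)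
    moreover have "(deriv (deriv \<phi>) a * A * ((1 + cnj a * 0)\<^sup>2 * deriv \<phi> a) -
        deriv \<phi> (?M 0) * (2 * cnj a * deriv \<phi> a)) /
        (((1 + cnj a * 0)\<^sup>2 * deriv \<phi> a) * ((1 + cnj a * 0)\<^sup>2 * deriv \<phi> a))
        = A * (deriv (deriv \<phi>) a / deriv \<phi> a) - 2 * cnj a"
      using nz[OF a] by (simp add: M0 field_simps)
    ultimately have "(K has_field_derivative A * (deriv (deriv \<phi>) a / deriv \<phi> a) - 2 * cnj a) (at 0)"
      by simp
    then have "(deriv \<psi> has_field_derivative A * (deriv (deriv \<phi>) a / deriv \<phi> a) - 2 * cnj a) (at 0)"
      by (rule has_field_derivative_transform_within_open[where S=unit_disc]) (use d\<psi> in auto)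
    then show ?thesis by (rule DERIV_imp_deriv)
  qed
  moreover have "ereal (cmod (taylor_coeff \<psi> 2)) \<le> ereal \<gamma>"
    unfolding L(2)[symmetric] family_order_def using \<psi>(1) by (intro SUP_upper)
  ultimately have "cmod ((A * (deriv (deriv \<phi>) a / deriv \<phi> a) - 2 * cnj a) / 2) \<le> \<gamma>"
    by (simp add: taylor_coeff_def numeral_2_eq_2)
  then show ?thesis by (simp add: A_def norm_divide)
qed

lemma unit_disc_holomorphic_log:
  assumes "f holomorphic_on unit_disc" "\<And>z. z \<in> unit_disc \<Longrightarrow> f z \<noteq> 0"
  obtains q where "q holomorphic_on unit_disc" "\<And>z. z \<in> unit_disc \<Longrightarrow> f z = exp (q z)"
proof (rule simply_connected_imp_holomorphic_log[OF assms(1)])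
  show "simply_connected unit_disc" by (simp add: convex_imp_simply_connected)
  show "locally path_connected unit_disc" by (simp add: convex_imp_locally_path_connected)
qed (use assms(2) that in auto)

text \<open>
  The curve \<open>z\<close> is the lift under \<open>\<phi>\<close> of a segment with direction \<open>\<omega>\<close>. Along it the conformal
  factor \<open>\<lambda> = (1 - (cmod z)\<^sup>2) * cmod (deriv \<phi> z)\<close> changes at rate at most
  \<open>2 * \<gamma> * cmod \<omega>\<close>: this is the coefficient bound, rewritten in the image plane. Hence \<open>\<lambda>\<close>
  stays above some \<open>k > 0\<close> if the segment is shorter than \<open>\<lambda> / (2 * \<gamma>)\<close> at its start. Then \<open>z\<close>
  has hyperbolic speed at most \<open>cmod \<omega> / k\<close>, so it covers only a bounded hyperbolic distance
  and remains in a compact part of the disc.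
\<close>

lemma ray_lift_stays_inside:
  assumes hol: "\<phi> holomorphic_on unit_disc" and nz: "\<And>z. z \<in> unit_disc \<Longrightarrow> deriv \<phi> z \<noteq> 0"
    and bound: "\<And>a. a \<in> unit_disc \<Longrightarrow>
      cmod (of_real (1 - (cmod a)\<^sup>2) * (deriv (deriv \<phi>) a / deriv \<phi> a) - 2 * cnj a) \<le> 2 * \<gamma>"
    and "0 < \<gamma>"
    and \<omega>: "2 * \<gamma> * cmod \<omega> < (1 - (cmod (z 0))\<^sup>2) * cmod (deriv \<phi> (z 0))"
    and z_in: "\<And>t. 0 \<le> t \<Longrightarrow> t < t0 \<Longrightarrow> z t \<in> unit_disc" and t0: "0 < t0" "t0 \<le> 1"
    and z_der: "\<And>t. 0 \<le> t \<Longrightarrow> t < t0 \<Longrightarrow> (z has_vector_derivative \<omega> / deriv \<phi> (z t)) (at t)"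
  shows "\<exists>c<1. \<forall>t. 0 \<le> t \<longrightarrow> t < t0 \<longrightarrow> cmod (z t) \<le> c"
proof -
  obtain q where q: "q holomorphic_on unit_disc" "\<And>z. z \<in> unit_disc \<Longrightarrow> deriv \<phi> z = exp (q z)"
    using unit_disc_holomorphic_log[OF holomorphic_deriv[OF hol] nz] by auto
  have dq: "deriv (deriv \<phi>) a = exp (q a) * deriv q a" if "a \<in> unit_disc" for a
  proof -
    have "((\<lambda>z. exp (q z)) has_field_derivative exp (q a) * deriv q a) (at a)"
      using q(1) that by (auto intro!: derivative_eq_intros holomorphic_derivI)
    then have "(deriv \<phi> has_field_derivative exp (q a) * deriv q a) (at a)"
      by (rule has_field_derivative_transform_within_open[where S=unit_disc]) (use that q(2) in auto)
    then show ?thesis by (rule DERIV_imp_deriv)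
  qed
  \<comment> \<open>The product \<open>y t * e t\<close> is the conformal factor along the curve; writing \<open>e\<close> through the
    logarithm \<open>q\<close> of \<open>deriv \<phi>\<close> makes it differentiable without square roots.\<close>
  define y where "y t = 1 - (Re (z t))\<^sup>2 - (Im (z t))\<^sup>2" for t
  define e where "e t = exp (Re (q (z t)))" for t
  define z' where "z' t = \<omega> / deriv \<phi> (z t)" for t
  have y: "y t = 1 - (cmod (z t))\<^sup>2" for t by (simp add: y_def cmod_power2)
  have y_pos: "y t > 0" if "0 \<le> t" "t < t0" for t
    using z_in[OF that] by (simp add: y power_less_one_iff)
  have e: "e t = cmod (deriv \<phi> (z t))" if "0 \<le> t" "t < t0" for t
    using q(2)[OF z_in[OF that]] by (simp add: e_def)
  have norm_z': "cmod (z' t) * e t = cmod \<omega>" if "0 \<le> t" "t < t0" for t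
    using nz[OF z_in[OF that]] e[OF that] by (simp add: z'_def norm_divide)
  have y_der: "(y has_real_derivative - 2 * Re (cnj (z t) * z' t)) (at t)" if "0 \<le> t" "t < t0" for t
  proof -
    note d = z_der[OF that, folded z'_def]
    have "((\<lambda>t. Re (z t)) has_real_derivative Re (z' t)) (at t)"
         "((\<lambda>t. Im (z t)) has_real_derivative Im (z' t)) (at t)"
      using bounded_linear.has_vector_derivative[OF bounded_linear_Re d]
            bounded_linear.has_vector_derivative[OF bounded_linear_Im d]
      by (simp_all add: has_real_derivative_iff_has_vector_derivative)
    note DERIV_diff[OF DERIV_diff[OF DERIV_const[of 1] DERIV_power[OF this(1), of 2]] DERIV_power[OF this(2), of 2]]
    then show ?thesis
      unfolding y_def by (rule DERIV_cong) (simp add: algebra_simps)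
  qed
  have e_der: "(e has_real_derivative e t * Re (z' t * deriv q (z t))) (at t)" if "0 \<le> t" "t < t0" for t
  proof -
    have "(q has_field_derivative deriv q (z t)) (at (z t))"
      using q(1) z_in[OF that] by (simp add: holomorphic_derivI)
    from field_vector_diff_chain_at[OF z_der[OF that, folded z'_def] this]
    have "((\<lambda>t. Re (q (z t))) has_real_derivative Re (z' t * deriv q (z t))) (at t)"
      using bounded_linear.has_vector_derivative[OF bounded_linear_Re]
      by (fastforce simp: has_real_derivative_iff_has_vector_derivative o_def)
    then show ?thesis unfolding e_def by (rule DERIV_fun_exp)
  qed
  define k where "k = y 0 * e 0 - 2 * \<gamma> * cmod \<omega>"
  have "k > 0" using \<omega> e[of 0] t0 by (simp add: k_def y)
  \<comment> \<open>The conformal factor decreases at rate at most \<open>2 * \<gamma> * cmod \<omega>\<close>.\<close>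
  have ye: "k \<le> y t * e t" if t: "0 \<le> t" "t < t0" for t
  proof -
    have "y 0 * e 0 + 2 * \<gamma> * cmod \<omega> * 0 \<le> y t * e t + 2 * \<gamma> * cmod \<omega> * t"
    proof (rule DERIV_nonneg_imp_nondecreasing[OF t(1)])
      fix s assume s: "0 \<le> s" "s \<le> t"
      then have s': "s < t0" using t by simp
      let ?d = "- 2 * Re (cnj (z s) * z' s) * e s + e s * Re (z' s * deriv q (z s)) * y s + 2 * \<gamma> * cmod \<omega>"
      have "((\<lambda>t. y t * e t + 2 * \<gamma> * cmod \<omega> * t) has_real_derivative ?d) (at s)"
        by (rule derivative_eq_intros y_der[OF s(1) s'] e_der[OF s(1) s'] refl | simp)+
      moreover have "0 \<le> ?d"
      proof -
        have "deriv (deriv \<phi>) (z s) / deriv \<phi> (z s) = deriv q (z s)"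
          using dq[OF z_in[OF s(1) s']] q(2)[OF z_in[OF s(1) s']] by simp
        then have b: "cmod (of_real (y s) * deriv q (z s) - 2 * cnj (z s)) \<le> 2 * \<gamma>"
          using bound[OF z_in[OF s(1) s']] by (simp only: y)
        have "- Re ((of_real (y s) * deriv q (z s) - 2 * cnj (z s)) * z' s)
            \<le> cmod ((of_real (y s) * deriv q (z s) - 2 * cnj (z s)) * z' s)"
          using abs_Re_le_cmod[of "(of_real (y s) * deriv q (z s) - 2 * cnj (z s)) * z' s"] by linarith
        also have "\<dots> \<le> 2 * \<gamma> * cmod (z' s)"
          unfolding norm_mult using b by (rule mult_right_mono) simp
        finally have "0 \<le> (Re ((of_real (y s) * deriv q (z s) - 2 * cnj (z s)) * z' s) + 2 * \<gamma> * cmod (z' s)) * e s"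
          by (intro mult_nonneg_nonneg) (auto simp: e_def)
        also have "\<dots> = Re ((of_real (y s) * deriv q (z s) - 2 * cnj (z s)) * z' s) * e s
             + 2 * \<gamma> * (cmod (z' s) * e s)"
          by (simp only: distrib_right mult.assoc)
        also have "\<dots> = ?d"
          unfolding norm_z'[OF s(1) s'] by (simp add: algebra_simps)
        finally show ?thesis .
      qed
      ultimately show "\<exists>y'. ((\<lambda>t. y t * e t + 2 * \<gamma> * cmod \<omega> * t) has_real_derivative y') (at s) \<and> 0 \<le> y'"
        by blast
    qed
    moreover have "2 * \<gamma> * cmod \<omega> * t \<le> 2 * \<gamma> * cmod \<omega> * 1"
      using t t0 \<open>0 < \<gamma>\<close> by (intro mult_left_mono) auto
    ultimately show ?thesis by (simp add: k_def)
  qed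
  define C where "C = 2 * cmod \<omega> / k"
  \<comment> \<open>A Gronwall argument for \<open>y\<close>, whose logarithmic derivative is at least \<open>- C\<close>.\<close>
  have lower: "y 0 * exp (- C) \<le> y t" if t: "0 \<le> t" "t < t0" for t
  proof -
    have "y 0 * exp (C * 0) \<le> y t * exp (C * t)"
    proof (rule DERIV_nonneg_imp_nondecreasing[OF t(1)])
      fix s assume s: "0 \<le> s" "s \<le> t"
      then have s': "s < t0" using t by simp
      let ?d = "(- 2 * Re (cnj (z s) * z' s) + C * y s) * exp (C * s)"
      have "((\<lambda>t. y t * exp (C * t)) has_real_derivative ?d) (at s)"
        by (rule derivative_eq_intros y_der[OF s(1) s'] refl | simp)+ (simp add: algebra_simps)
      moreover have "0 \<le> ?d"
      proof -
        have "Re (cnj (z s) * z' s) \<le> cmod (cnj (z s) * z' s)" by (rule complex_Re_le_cmod)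
        also have "\<dots> \<le> 1 * cmod (z' s)"
          unfolding norm_mult using z_in[OF s(1) s'] by (intro mult_right_mono) auto
        finally have 1: "Re (cnj (z s) * z' s) \<le> cmod (z' s)" by simp
        have "k * cmod (z' s) \<le> y s * e s * cmod (z' s)"
          using ye[OF s(1) s'] by (rule mult_right_mono) simp
        also have "\<dots> = y s * cmod \<omega>" using norm_z'[OF s(1) s'] by (simp add: mult_ac)
        finally have "cmod (z' s) \<le> y s * cmod \<omega> / k"
          using \<open>k > 0\<close> by (simp add: field_simps)
        with 1 have "2 * Re (cnj (z s) * z' s) \<le> 2 * (y s * cmod \<omega> / k)" by linarith
        also have "\<dots> = C * y s" by (simp add: C_def)
        finally have "2 * Re (cnj (z s) * z' s) \<le> C * y s" .
        then show ?thesis by (intro mult_nonneg_nonneg) auto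
      qed
      ultimately show "\<exists>y'. ((\<lambda>t. y t * exp (C * t)) has_real_derivative y') (at s) \<and> 0 \<le> y'"
        by blast
    qed
    also have "\<dots> \<le> y t * exp C"
      using t t0 y_pos[OF t] \<open>k > 0\<close> mult_left_mono[of t 1 C]
      by (intro mult_left_mono) (auto simp: C_def)
    finally have "y 0 \<le> y t * exp C" by simp
    then show ?thesis by (simp add: exp_minus field_simps)
  qed
  define \<delta> where "\<delta> = y 0 * exp (- C)"
  have "\<delta> > 0" using y_pos[of 0] t0 by (simp add: \<delta>_def)
  show ?thesis
  proof (intro exI conjI allI impI)
    show "sqrt (1 - \<delta>) < 1" using \<open>\<delta> > 0\<close> by simp
    show "cmod (z t) \<le> sqrt (1 - \<delta>)" if "0 \<le> t" "t < t0" for t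
      using lower[OF that] by (intro real_le_rsqrt) (simp add: y \<delta>_def)
  qed
qed

text \<open>
  A covering theorem of Koebe type: the constant \<open>1 / 4\<close> for the class \<open>S\<close>, where \<open>\<gamma> = 2\<close>,
  becomes \<open>1 / (2 * \<gamma>)\<close>. If a segment from \<open>\<phi> a\<close> left the image at a first point, its
  preimage up to there would stay in a compact part of the disc, and the exit point would be the
  image of a point of that compact set.
\<close>

lemma univalent_image_contains_ball:
  assumes hol: "\<phi> holomorphic_on unit_disc" and inj: "inj_on \<phi> unit_disc"
    and bound: "\<And>a. a \<in> unit_disc \<Longrightarrow>
      cmod (of_real (1 - (cmod a)\<^sup>2) * (deriv (deriv \<phi>) a / deriv \<phi> a) - 2 * cnj a) \<le> 2 * \<gamma>"
    and "0 < \<gamma>" and a: "a \<in> unit_disc"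
  shows "ball (\<phi> a) ((1 - (cmod a)\<^sup>2) * cmod (deriv \<phi> a) / (2 * \<gamma>)) \<subseteq> \<phi> ` unit_disc"
proof
  fix w1 assume w1: "w1 \<in> ball (\<phi> a) ((1 - (cmod a)\<^sup>2) * cmod (deriv \<phi> a) / (2 * \<gamma>))"
  define \<omega> where "\<omega> = w1 - \<phi> a"
  have \<omega>: "2 * \<gamma> * cmod \<omega> < (1 - (cmod a)\<^sup>2) * cmod (deriv \<phi> a)"
    using w1 \<open>0 < \<gamma>\<close> by (simp add: \<omega>_def dist_norm norm_minus_commute field_simps)
  have nz: "deriv \<phi> z \<noteq> 0" if "z \<in> unit_disc" for z
    using holomorphic_injective_imp_regular[OF hol _ inj that] by simp
  let ?V = "\<phi> ` unit_disc"
  have "open ?V" using hol inj by (intro open_mapping_thm3) auto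
  obtain g where g: "g holomorphic_on ?V"
      "\<And>z. z \<in> unit_disc \<Longrightarrow> deriv \<phi> z * deriv g (\<phi> z) = 1" "\<And>z. z \<in> unit_disc \<Longrightarrow> g (\<phi> z) = z"
    using holomorphic_has_inverse[OF hol _ inj] by auto
  define w where "w t = \<phi> a + of_real t * \<omega>" for t :: real
  have contw: "continuous_on UNIV w" unfolding w_def by (intro continuous_intros)
  show "w1 \<in> ?V"
  proof (rule ccontr)
    assume "w1 \<notin> ?V"
    define T where "T = {0..1} \<inter> w -` (- ?V)"
    have "compact T"
      unfolding T_def using \<open>open ?V\<close> contw
      by (intro compact_Int_closed) (auto simp: continuous_on_closed_vimage)
    moreover have "1 \<in> T" using \<open>w1 \<notin> ?V\<close> by (simp add: T_def w_def \<omega>_def)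
    ultimately obtain t0 where t0: "t0 \<in> T" "\<And>t. t \<in> T \<Longrightarrow> t0 \<le> t"
      using compact_attains_inf[of T] by blast
    have "w 0 \<in> ?V" using a by (simp add: w_def)
    then have t0': "0 < t0" "t0 \<le> 1" "w t0 \<notin> ?V"
      using t0(1) by (auto simp: T_def less_le)
    have wV: "w t \<in> ?V" if "0 \<le> t" "t < t0" for t
      using that t0(2)[of t] t0' by (auto simp: T_def)
    define z where "z t = g (w t)" for t
    have z: "z t \<in> unit_disc" "\<phi> (z t) = w t" if "0 \<le> t" "t < t0" for t
      using wV[OF that] g(3) by (auto simp: z_def)
    have z0: "z 0 = a" using g(3)[OF a] by (simp add: z_def w_def)
    have z_der: "(z has_vector_derivative \<omega> / deriv \<phi> (z t)) (at t)" if t: "0 \<le> t" "t < t0" for t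
    proof -
      have "(w has_vector_derivative \<omega>) (at t)"
        unfolding w_def
        by (auto intro!: derivative_eq_intros simp: has_vector_derivative_def scaleR_conv_of_real)
      moreover have "(g has_field_derivative deriv g (w t)) (at (w t))"
        using g(1) \<open>open ?V\<close> wV[OF t] by (rule holomorphic_derivI)
      ultimately have "(g \<circ> w has_vector_derivative \<omega> * deriv g (w t)) (at t)"
        by (rule field_vector_diff_chain_at)
      moreover have "deriv g (w t) = 1 / deriv \<phi> (z t)"
        using g(2)[OF z(1)[OF t]] z(2)[OF t] nz[OF z(1)[OF t]] by (simp add: field_simps)
      ultimately show ?thesis by (simp add: z_def[abs_def] o_def)
    qed
    have "\<exists>c<1. \<forall>t. 0 \<le> t \<longrightarrow> t < t0 \<longrightarrow> cmod (z t) \<le> c"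
    proof (rule ray_lift_stays_inside[OF hol nz bound \<open>0 < \<gamma>\<close>])
      show "2 * \<gamma> * cmod \<omega> < (1 - (cmod (z 0))\<^sup>2) * cmod (deriv \<phi> (z 0))"
        using \<omega> by (simp only: z0)
    qed (use z(1) t0' z_der in auto)
    then obtain c where c: "c < 1" "\<And>t. 0 \<le> t \<Longrightarrow> t < t0 \<Longrightarrow> cmod (z t) \<le> c"
      by blast
    have "cball 0 c \<subseteq> unit_disc" using c(1) by auto
    then have "compact (\<phi> ` cball 0 c)"
      using hol by (intro compact_continuous_image)
        (auto intro: holomorphic_on_imp_continuous_on continuous_on_subset)
    then have "closed (\<phi> ` cball 0 c)" by (rule compact_imp_closed)
    moreover have "(w \<longlongrightarrow> w t0) (at_left t0)"
      using contw by (auto simp: continuous_on_eq_continuous_at isCont_def intro: tendsto_within_subset)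
    moreover have "\<forall>\<^sub>F t in at_left t0. w t \<in> \<phi> ` cball 0 c"
    proof -
      have "\<forall>\<^sub>F t in at_left t0. t \<in> {0<..<t0}" using t0'(1) by (rule eventually_at_left_field[THEN iffD2, OF exI, OF conjI]) auto
      then show ?thesis
      proof eventually_elim
        case (elim t)
        then show ?case using c(2)[of t] z[of t] by (intro image_eqI[of _ _ "z t"]) auto
      qed
    qed
    ultimately have "w t0 \<in> \<phi> ` cball 0 c"
      by (intro Lim_in_closed_set[of _ w "at_left t0"]) auto
    then show False using t0'(3) \<open>cball 0 c \<subseteq> unit_disc\<close> by blast
  qed
qed

text \<open>
  Pulling the disc of radius \<open>\<rho>\<close> about \<open>\<phi> a\<close> back by the inverse of \<open>\<phi>\<close> gives a holomorphic
  map into the unit disc. If \<open>\<rho>\<close> exceeds \<open>cmod (\<phi> a)\<close>, that disc contains \<open>0 = \<phi> 0\<close>, and the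
  Schwarz lemma, centred at \<open>a\<close>, bounds the pseudohyperbolic distance \<open>cmod a\<close> from \<open>a\<close> to \<open>0\<close> by
  \<open>cmod (\<phi> a) / \<rho>\<close>. If not, \<open>cmod a < 1\<close> is enough.
\<close>

lemma univalent_logarithmic_derivative_bound:
  assumes hol: "\<phi> holomorphic_on unit_disc" and inj: "inj_on \<phi> unit_disc" and "\<phi> 0 = 0"
    and bound: "\<And>a. a \<in> unit_disc \<Longrightarrow>
      cmod (of_real (1 - (cmod a)\<^sup>2) * (deriv (deriv \<phi>) a / deriv \<phi> a) - 2 * cnj a) \<le> 2 * \<gamma>"
    and "0 < \<gamma>" and a: "a \<in> unit_disc"
  shows "(1 - (cmod a)\<^sup>2) * cmod (a * deriv \<phi> a) \<le> 2 * \<gamma> * cmod (\<phi> a)"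
proof -
  define \<rho> where "\<rho> = (1 - (cmod a)\<^sup>2) * cmod (deriv \<phi> a) / (2 * \<gamma>)"
  have sub: "ball (\<phi> a) \<rho> \<subseteq> \<phi> ` unit_disc"
    unfolding \<rho>_def by (rule univalent_image_contains_ball[OF hol inj bound \<open>0 < \<gamma>\<close> a])
  have "deriv \<phi> a \<noteq> 0"
    using holomorphic_injective_imp_regular[OF hol _ inj a] by simp
  then have "\<rho> > 0" using a \<open>0 < \<gamma>\<close> by (simp add: \<rho>_def power_less_one_iff)
  have "cmod a * \<rho> \<le> cmod (\<phi> a)"
  proof (cases "cmod (\<phi> a) < \<rho>")
    case False
    have "cmod a * \<rho> \<le> 1 * \<rho>" using a \<open>\<rho> > 0\<close> by (intro mult_right_mono) auto
    then show ?thesis using False by simp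
  next
    case True
    obtain g where g: "g holomorphic_on \<phi> ` unit_disc" "\<And>z. z \<in> unit_disc \<Longrightarrow> g (\<phi> z) = z"
      by (rule holomorphic_has_inverse[OF hol open_ball inj]) blast
    define m where "m \<zeta> = \<phi> a + of_real \<rho> * \<zeta>" for \<zeta>
    have m: "m ` unit_disc \<subseteq> \<phi> ` unit_disc"
      using sub \<open>\<rho> > 0\<close> by (fastforce simp: m_def dist_norm norm_mult)
    have gim: "g ` \<phi> ` unit_disc \<subseteq> unit_disc" using g(2) by auto
    define h where "h = Moebius_function 0 a \<circ> (g \<circ> m)"
    have "m holomorphic_on unit_disc" unfolding m_def by (intro holomorphic_intros)
    then have gm: "(g \<circ> m) holomorphic_on unit_disc"
      by (rule holomorphic_on_compose_gen[OF _ g(1) m])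
    have gmim: "(g \<circ> m) ` unit_disc \<subseteq> unit_disc" using m gim by (auto simp: image_subset_iff)
    have "h holomorphic_on unit_disc"
      unfolding h_def
      by (rule holomorphic_on_compose_gen[OF gm Moebius_function_holomorphic gmim]) (use a in simp)
    moreover have "h 0 = 0" using g(2)[OF a] by (simp add: h_def m_def Moebius_function_eq_zero)
    moreover have "cmod (h \<zeta>) < 1" if "cmod \<zeta> < 1" for \<zeta>
      unfolding h_def o_apply[of "Moebius_function 0 a"]
      by (rule Moebius_function_norm_lt_1) (use a gmim that in \<open>auto simp: image_subset_iff\<close>)
    moreover define \<xi> where "\<xi> = - \<phi> a / of_real \<rho>"
    moreover have "cmod \<xi> < 1" using True \<open>\<rho> > 0\<close> by (simp add: \<xi>_def norm_divide)
    ultimately have "cmod (h \<xi>) \<le> cmod \<xi>" using Schwarz_Lemma(1) by blast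
    moreover have "m \<xi> = 0" using \<open>\<rho> > 0\<close> by (simp add: m_def \<xi>_def)
    then have "h \<xi> = - a"
      using g(2)[of 0] \<open>\<phi> 0 = 0\<close> by (simp add: h_def Moebius_function_simple)
    ultimately show ?thesis using \<open>\<rho> > 0\<close> by (simp add: \<xi>_def norm_divide field_simps)
  qed
  then show ?thesis using \<open>0 < \<gamma>\<close> by (simp add: \<rho>_def norm_mult field_simps)
qed

section \<open>The integral operator\<close>

lemma over_id_holomorphic:
  assumes "\<phi> holomorphic_on unit_disc" "\<phi> 0 = 0"
  shows "over_id \<phi> holomorphic_on unit_disc"
  by (rule pole_theorem_open_0[OF assms(1) open_ball, of 0]) (auto simp: over_id_def assms(2))

lemma over_id_nonzero:
  assumes "\<phi> holomorphic_on unit_disc" "inj_on \<phi> unit_disc" "\<phi> 0 = 0" "z \<in> unit_disc"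
  shows "over_id \<phi> z \<noteq> 0"
proof (cases "z = 0")
  case True
  then show ?thesis
    using holomorphic_injective_imp_regular[of \<phi> unit_disc 0] assms by (simp add: over_id_def)
next
  case False
  then have "\<phi> z \<noteq> \<phi> 0" using assms(2,4) by (auto dest: inj_onD)
  then show ?thesis using False assms(3) by (simp add: over_id_def)
qed

lemma disc_log_properties:
  assumes "f holomorphic_on unit_disc" "\<And>z. z \<in> unit_disc \<Longrightarrow> f z \<noteq> 0" "f 0 = 1"
  shows "disc_log f holomorphic_on unit_disc"
    "\<And>z. z \<in> unit_disc \<Longrightarrow> exp (disc_log f z) = f z"
proof -
  obtain q where q: "q holomorphic_on unit_disc" "\<And>z. z \<in> unit_disc \<Longrightarrow> f z = exp (q z)"
    using unit_disc_holomorphic_log[OF assms(1,2)] by blast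
  have "(\<lambda>z. q z - q 0) holomorphic_on unit_disc" using q(1) by (intro holomorphic_intros)
  moreover have "\<forall>z\<in>unit_disc. exp (q z - q 0) = f z"
    using q(2) q(2)[of 0] assms(3) by (simp add: exp_diff)
  ultimately have "\<exists>g. g holomorphic_on unit_disc \<and> g 0 = 0 \<and> (\<forall>z\<in>unit_disc. exp (g z) = f z)"
    by (intro exI[of _ "\<lambda>z. q z - q 0"]) simp
  then have "disc_log f holomorphic_on unit_disc \<and> disc_log f 0 = 0 \<and> (\<forall>z\<in>unit_disc. exp (disc_log f z) = f z)"
    unfolding disc_log_def by (rule someI_ex)
  then show "disc_log f holomorphic_on unit_disc"
    "\<And>z. z \<in> unit_disc \<Longrightarrow> exp (disc_log f z) = f z" by auto
qed

text \<open>
  The identity is the logarithmic differentiation of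
  \<open>\<phi> z = z * (D z) powr (1 / \<alpha>) * (1 - z) powr \<beta>\<close>, multiplied out so that it also makes sense at
  \<open>z = 0\<close>. It is derived from the logarithm \<open>l\<close> of the base, so that \<open>\<alpha> = 0\<close> is included.
\<close>

lemma C_op_integrand:
  fixes \<alpha> \<beta> :: real
  assumes hol: "\<phi> holomorphic_on unit_disc" and inj: "inj_on \<phi> unit_disc"
    and "\<phi> 0 = 0" "deriv \<phi> 0 = 1"
  defines "D \<equiv> disc_power (\<lambda>\<zeta>. over_id \<phi> \<zeta> / (1 - \<zeta>) powr of_real \<beta>) \<alpha>"
  shows "D holomorphic_on unit_disc" "\<And>z. D z \<noteq> 0"
    "\<And>z. z \<in> unit_disc \<Longrightarrow>
       z * deriv D z * \<phi> z = of_real \<alpha> * (z * deriv \<phi> z + (of_real \<beta> * z / (1 - z) - 1) * \<phi> z) * D z"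
proof -
  define p where "p \<zeta> = over_id \<phi> \<zeta> / (1 - \<zeta>) powr of_real \<beta>" for \<zeta>
  define l where "l = disc_log p"
  define E where "E \<zeta> = exp (of_real \<beta> * Ln (1 - \<zeta>))" for \<zeta>
  have D: "D z = exp (of_real \<alpha> * l z)" for z
    by (simp add: D_def disc_power_def l_def p_def[abs_def])
  have ne: "1 - \<zeta> \<noteq> 0" "1 - \<zeta> \<notin> \<real>\<^sub>\<le>\<^sub>0" if "\<zeta> \<in> unit_disc" for \<zeta>
  proof -
    have "Re (1 - \<zeta>) > 0" using that complex_Re_le_cmod[of \<zeta>] by simp
    then show "1 - \<zeta> \<noteq> 0" "1 - \<zeta> \<notin> \<real>\<^sub>\<le>\<^sub>0" by (auto simp: complex_nonpos_Reals_iff)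
  qed
  have E: "(1 - \<zeta>) powr of_real \<beta> = E \<zeta>" if "\<zeta> \<in> unit_disc" for \<zeta>
    using ne(1)[OF that] by (simp add: powr_def E_def)
  have "(\<lambda>\<zeta>. over_id \<phi> \<zeta> / E \<zeta>) holomorphic_on unit_disc"
    unfolding E_def using ne
    by (intro holomorphic_intros over_id_holomorphic hol \<open>\<phi> 0 = 0\<close>) auto
  then have "p holomorphic_on unit_disc"
    by (rule holomorphic_transform) (simp add: p_def E)
  moreover have "p z \<noteq> 0" if "z \<in> unit_disc" for z
    unfolding p_def E[OF that] using over_id_nonzero[OF hol inj \<open>\<phi> 0 = 0\<close> that] by (simp add: E_def)
  moreover have "p 0 = 1" using \<open>deriv \<phi> 0 = 1\<close> by (simp add: p_def over_id_def)
  ultimately have l: "l holomorphic_on unit_disc" "\<And>z. z \<in> unit_disc \<Longrightarrow> exp (l z) = p z"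
    unfolding l_def using disc_log_properties by blast+
  show "D holomorphic_on unit_disc"
    unfolding D[abs_def] by (intro holomorphic_intros l(1))
  show "D z \<noteq> 0" for z by (simp add: D)
  fix z assume z: "z \<in> unit_disc"
  have l': "(l has_field_derivative deriv l z) (at z)" using l(1) z by (simp add: holomorphic_derivI)
  have D': "deriv D z = of_real \<alpha> * deriv l z * D z"
    unfolding D[abs_def] using DERIV_fun_exp[OF DERIV_cmult[OF l', of "of_real \<alpha>"]]
    by (simp add: DERIV_imp_deriv mult_ac)
  have \<phi>: "\<phi> \<zeta> = \<zeta> * (exp (l \<zeta>) * E \<zeta>)" if "\<zeta> \<in> unit_disc" for \<zeta>
    using l(2)[OF that] \<open>\<phi> 0 = 0\<close> by (simp add: p_def E[OF that] over_id_def E_def)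
  have E': "(E has_field_derivative E z * (- of_real \<beta> / (1 - z))) (at z)"
    unfolding E_def using ne[OF z]
    by (auto intro!: derivative_eq_intros simp: divide_inverse mult_ac)
  have "((\<lambda>\<zeta>. \<zeta> * (exp (l \<zeta>) * E \<zeta>)) has_field_derivative
      exp (l z) * E z + z * (exp (l z) * deriv l z * E z + exp (l z) * (E z * (- of_real \<beta> / (1 - z))))) (at z)"
    by (rule derivative_eq_intros l' E' refl | simp)+
  then have "(\<phi> has_field_derivative
      exp (l z) * E z + z * (exp (l z) * deriv l z * E z + exp (l z) * (E z * (- of_real \<beta> / (1 - z))))) (at z)"
    by (rule has_field_derivative_transform_within_open[where S=unit_disc]) (use z \<phi> in auto)
  then have "deriv \<phi> z =
      exp (l z) * E z + z * (exp (l z) * deriv l z * E z + exp (l z) * (E z * (- of_real \<beta> / (1 - z))))"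
    by (rule DERIV_imp_deriv)
  then have "z * deriv \<phi> z =
      z * (exp (l z) * E z + z * (exp (l z) * deriv l z * E z + exp (l z) * (E z * (- of_real \<beta> / (1 - z)))))"
    by (rule arg_cong)
  also have "\<dots> = \<phi> z + z * deriv l z * \<phi> z - of_real \<beta> * z / (1 - z) * \<phi> z"
    unfolding \<phi>[OF z] by (simp add: algebra_simps)
  finally have "z * deriv \<phi> z = \<phi> z + z * deriv l z * \<phi> z - of_real \<beta> * z / (1 - z) * \<phi> z" .
  then show "z * deriv D z * \<phi> z =
      of_real \<alpha> * (z * deriv \<phi> z + (of_real \<beta> * z / (1 - z) - 1) * \<phi> z) * D z"
    unfolding D' by (simp add: algebra_simps)
qed

lemma C_op_has_field_derivative:
  fixes \<alpha> \<beta> :: real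
  assumes D: "disc_power (\<lambda>\<zeta>. over_id \<phi> \<zeta> / (1 - \<zeta>) powr of_real \<beta>) \<alpha> holomorphic_on unit_disc"
      (is "?D holomorphic_on _")
    and z: "z \<in> unit_disc"
  shows "(C_op \<alpha> \<beta> \<phi> has_field_derivative
    disc_power (\<lambda>\<zeta>. over_id \<phi> \<zeta> / (1 - \<zeta>) powr of_real \<beta>) \<alpha> z) (at z)"
proof -
  obtain g where g: "\<And>x. x \<in> unit_disc \<Longrightarrow> (g has_field_derivative ?D x) (at x within unit_disc)"
    using holomorphic_convex_primitive'[OF _ _ D] by auto
  have C: "C_op \<alpha> \<beta> \<phi> x = g x - g 0" if "x \<in> unit_disc" for x
  proof -
    have "closed_segment 0 x \<subseteq> unit_disc"
      using that by (intro closed_segment_subset) auto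
    then have "(?D has_contour_integral g x - g 0) (linepath 0 x)"
      using contour_integral_primitive[OF g, of "linepath 0 x"] by simp
    then show ?thesis unfolding C_op_def by (rule contour_integral_unique)
  qed
  have "((\<lambda>x. g x - g 0) has_field_derivative ?D z - 0) (at z)"
    using g[OF z] at_within_open[OF z open_ball] by (intro DERIV_diff DERIV_const) simp
  then have "(C_op \<alpha> \<beta> \<phi> has_field_derivative ?D z - 0) (at z)"
    by (rule has_field_derivative_transform_within_open[where S=unit_disc]) (use z C in auto)
  then show ?thesis by simp
qed

text \<open>
  After division by \<open>\<phi> z\<close>, the logarithmic derivative is
  \<open>\<alpha> * (z * deriv \<phi> z / \<phi> z - 1 + \<beta> * z / (1 - z))\<close>. Its first term contributes \<open>2 * \<gamma>\<close>, the
  second \<open>1 - (cmod z)\<^sup>2\<close>; in the third, \<open>1 - cmod z \<le> cmod (1 - z)\<close> cancels against the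
  factor \<open>1 - cmod z\<close> of \<open>1 - (cmod z)\<^sup>2\<close>.
\<close>

lemma C_op_integrand_bound:
  fixes \<alpha> \<beta> \<gamma> :: real
  assumes hol: "\<phi> holomorphic_on unit_disc" and inj: "inj_on \<phi> unit_disc"
    and \<phi>0: "\<phi> 0 = 0" "deriv \<phi> 0 = 1" and nonneg: "0 \<le> \<alpha>" "0 \<le> \<beta>" "0 \<le> \<gamma>"
    and log_bound: "\<And>a. a \<in> unit_disc \<Longrightarrow>
      (1 - (cmod a)\<^sup>2) * cmod (a * deriv \<phi> a) \<le> 2 * \<gamma> * cmod (\<phi> a)"
    and z: "z \<in> unit_disc"
  defines "D \<equiv> disc_power (\<lambda>\<zeta>. over_id \<phi> \<zeta> / (1 - \<zeta>) powr of_real \<beta>) \<alpha>"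
  shows "(1 - (cmod z)\<^sup>2) * cmod (z * deriv D z)
    \<le> \<alpha> * (2 * \<gamma> + (1 - (cmod z)\<^sup>2) + \<beta> * cmod z * (1 + cmod z)) * cmod (D z)"
proof (cases "z = 0")
  case True
  then show ?thesis using nonneg by simp
next
  case False
  let ?r = "cmod z"
  have r: "0 \<le> ?r" "?r < 1" using z by auto
  then have r2: "0 \<le> 1 - ?r\<^sup>2" by (simp add: power_le_one)
  have "\<phi> z \<noteq> \<phi> 0" using inj z False by (auto dest: inj_onD)
  then have \<phi>z: "cmod (\<phi> z) > 0" using \<phi>0 by simp
  have kernel: "(1 - ?r\<^sup>2) * cmod (of_real \<beta> * z / (1 - z) - 1) \<le> \<beta> * ?r * (1 + ?r) + (1 - ?r\<^sup>2)"
  proof -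
    have one: "1 - ?r \<le> cmod (1 - z)" using norm_triangle_ineq2[of 1 z] by simp
    have "(1 - ?r\<^sup>2) * (\<beta> * ?r / cmod (1 - z)) \<le> (1 - ?r\<^sup>2) * (\<beta> * ?r / (1 - ?r))"
      using one r r2 nonneg by (intro mult_left_mono divide_left_mono mult_pos_pos) auto
    also have "\<dots> = \<beta> * ?r * (1 + ?r)"
      using r by (simp add: power2_eq_square field_simps)
    finally have 1: "(1 - ?r\<^sup>2) * (\<beta> * ?r / cmod (1 - z)) \<le> \<beta> * ?r * (1 + ?r)" .
    have "cmod (of_real \<beta> * z / (1 - z) - 1) \<le> \<beta> * ?r / cmod (1 - z) + 1"
      using norm_triangle_ineq4[of "of_real \<beta> * z / (1 - z)" 1] nonneg
      by (simp add: norm_mult norm_divide)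
    then have "(1 - ?r\<^sup>2) * cmod (of_real \<beta> * z / (1 - z) - 1)
        \<le> (1 - ?r\<^sup>2) * (\<beta> * ?r / cmod (1 - z) + 1)"
      using r2 by (rule mult_left_mono)
    then show ?thesis using 1 by (simp only: distrib_left mult_1_right)
  qed
  let ?M = "2 * \<gamma> + (1 - ?r\<^sup>2) + \<beta> * ?r * (1 + ?r)"
  have "(1 - ?r\<^sup>2) * cmod (z * deriv \<phi> z + (of_real \<beta> * z / (1 - z) - 1) * \<phi> z)
      \<le> (1 - ?r\<^sup>2) * (cmod (z * deriv \<phi> z) + cmod (of_real \<beta> * z / (1 - z) - 1) * cmod (\<phi> z))"
    using r2 norm_triangle_ineq[of "z * deriv \<phi> z" "(of_real \<beta> * z / (1 - z) - 1) * \<phi> z"]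
    by (intro mult_left_mono) (simp_all only: norm_mult)
  also have "\<dots> = (1 - ?r\<^sup>2) * cmod (z * deriv \<phi> z)
      + ((1 - ?r\<^sup>2) * cmod (of_real \<beta> * z / (1 - z) - 1)) * cmod (\<phi> z)"
    by (simp only: distrib_left mult.assoc)
  also have "\<dots> \<le> 2 * \<gamma> * cmod (\<phi> z) + (\<beta> * ?r * (1 + ?r) + (1 - ?r\<^sup>2)) * cmod (\<phi> z)"
    using kernel by (intro add_mono log_bound[OF z] mult_right_mono) auto
  also have "\<dots> = ?M * cmod (\<phi> z)" by (simp add: algebra_simps)
  finally have main: "(1 - ?r\<^sup>2) * cmod (z * deriv \<phi> z + (of_real \<beta> * z / (1 - z) - 1) * \<phi> z)
      \<le> ?M * cmod (\<phi> z)" .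
  have "((1 - ?r\<^sup>2) * cmod (z * deriv D z)) * cmod (\<phi> z) = (1 - ?r\<^sup>2) * cmod (z * deriv D z * \<phi> z)"
    by (simp only: norm_mult mult.assoc)
  also have "z * deriv D z * \<phi> z
      = of_real \<alpha> * (z * deriv \<phi> z + (of_real \<beta> * z / (1 - z) - 1) * \<phi> z) * D z"
    unfolding D_def by (rule C_op_integrand(3)[OF hol inj \<phi>0 z])
  also have "(1 - ?r\<^sup>2) * cmod \<dots> =
      (\<alpha> * cmod (D z)) * ((1 - ?r\<^sup>2) * cmod (z * deriv \<phi> z + (of_real \<beta> * z / (1 - z) - 1) * \<phi> z))"
    using nonneg(1) by (simp only: norm_mult norm_of_real abs_of_nonneg mult_ac)
  also have "\<dots> \<le> (\<alpha> * cmod (D z)) * (?M * cmod (\<phi> z))"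
    using main nonneg(1) by (intro mult_left_mono) auto
  finally have "((1 - ?r\<^sup>2) * cmod (z * deriv D z)) * cmod (\<phi> z) \<le> (\<alpha> * ?M * cmod (D z)) * cmod (\<phi> z)"
    by (simp only: mult_ac)
  then show ?thesis using \<phi>z by (rule mult_right_le_imp_le)
qed

text \<open>
  The rotation only substitutes \<open>exp (\<i> * \<theta>) * z\<close> for \<open>z\<close> in the derivative, and the bound depends
  on \<open>cmod z\<close> alone.
\<close>

lemma rotated_C_op:
  fixes \<alpha> \<beta> \<gamma> \<theta> :: real
  assumes hol: "\<phi> holomorphic_on unit_disc" and inj: "inj_on \<phi> unit_disc"
    and \<phi>0: "\<phi> 0 = 0" "deriv \<phi> 0 = 1" and nonneg: "0 \<le> \<alpha>" "0 \<le> \<beta>" "0 \<le> \<gamma>"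
    and log_bound: "\<And>a. a \<in> unit_disc \<Longrightarrow>
      (1 - (cmod a)\<^sup>2) * cmod (a * deriv \<phi> a) \<le> 2 * \<gamma> * cmod (\<phi> a)"
  obtains d where "d holomorphic_on unit_disc" "\<And>z. z \<in> unit_disc \<Longrightarrow> d z \<noteq> 0"
    "\<And>z. z \<in> unit_disc \<Longrightarrow> (C_op_rot \<theta> \<alpha> \<beta> \<phi> has_field_derivative d z) (at z)"
    "\<And>z. z \<in> unit_disc \<Longrightarrow> (1 - (cmod z)\<^sup>2) * cmod (z * deriv d z)
       \<le> \<alpha> * (2 * \<gamma> + (1 - (cmod z)\<^sup>2) + \<beta> * cmod z * (1 + cmod z)) * cmod (d z)"
proof
  define D where "D = disc_power (\<lambda>\<zeta>. over_id \<phi> \<zeta> / (1 - \<zeta>) powr of_real \<beta>) \<alpha>"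
  define e where "e = exp (\<i> * of_real \<theta>)"
  define d where "d z = D (e * z)" for z
  have norm_e: "cmod (e * z) = cmod z" for z by (simp add: e_def norm_mult)
  then have ez: "e * z \<in> unit_disc" if "z \<in> unit_disc" for z using that by simp
  note D = C_op_integrand(1,2)[OF hol inj \<phi>0, of \<beta> \<alpha>, folded D_def]
  have e_der: "((\<lambda>z. e * z) has_field_derivative e) (at z)" for z by (rule DERIV_cmult_Id)
  have d_der: "(d has_field_derivative deriv D (e * z) * e) (at z)" if "z \<in> unit_disc" for z
    unfolding d_def
    by (rule DERIV_chain2[where f=D and g="\<lambda>z. e * z", OF _ e_der])
       (use D(1) ez[OF that] in \<open>simp add: holomorphic_derivI\<close>)
  show "d holomorphic_on unit_disc"
    using d_der holomorphic_on_open[OF open_ball] by blast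
  show "d z \<noteq> 0" for z by (simp add: d_def D)
  show "(C_op_rot \<theta> \<alpha> \<beta> \<phi> has_field_derivative d z) (at z)" if "z \<in> unit_disc" for z
  proof -
    have "(C_op \<alpha> \<beta> \<phi> has_field_derivative D (e * z)) (at (e * z))"
      unfolding D_def by (rule C_op_has_field_derivative[OF _ ez[OF that]]) (use D(1) in \<open>simp add: D_def\<close>)
    from DERIV_cmult[OF DERIV_chain2[where f="C_op \<alpha> \<beta> \<phi>" and g="\<lambda>z. e * z", OF this e_der], of "exp (- \<i> * of_real \<theta>)"]
    have "(C_op_rot \<theta> \<alpha> \<beta> \<phi> has_field_derivative exp (- \<i> * of_real \<theta>) * (D (e * z) * e)) (at z)"
      by (simp add: C_op_rot_def[abs_def] e_def)
    moreover have "exp (- \<i> * of_real \<theta>) * e = 1" by (simp add: e_def flip: exp_add)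
    then have "exp (- \<i> * of_real \<theta>) * (D (e * z) * e) = d z" by (simp add: d_def)
    ultimately show ?thesis by simp
  qed
  show "(1 - (cmod z)\<^sup>2) * cmod (z * deriv d z)
       \<le> \<alpha> * (2 * \<gamma> + (1 - (cmod z)\<^sup>2) + \<beta> * cmod z * (1 + cmod z)) * cmod (d z)"
    if "z \<in> unit_disc" for z
  proof -
    have "z * deriv d z = (e * z) * deriv D (e * z)"
      using DERIV_imp_deriv[OF d_der[OF that]] by simp
    then show ?thesis
      using C_op_integrand_bound[OF hol inj \<phi>0 nonneg log_bound ez[OF that], folded D_def]
      by (simp only: norm_e d_def)
  qed
qed

section \<open>Univalence of the shears\<close>

text \<open>
  With \<open>\<omega> = c * w\<close>, the derivative of \<open>H + \<epsilon> * G\<close> is \<open>(1 + \<epsilon> * \<omega>) / (1 - \<omega>) * d\<close>, so its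
  logarithmic derivative exceeds that of \<open>d\<close> by
  \<open>(1 + \<epsilon>) * deriv \<omega> / ((1 - \<omega>) * (1 + \<epsilon> * \<omega>))\<close>. For \<open>c \<le> 1 / 2\<close> and \<open>x = cmod (w z)\<close> one
  has \<open>1 - x \<le> 1 - 2 * c * x \<le> (1 - c * x)\<^sup>2\<close>, hence
  \<open>1 - x\<^sup>2 \<le> (1 + x) * (1 - c * x)\<^sup>2\<close>: the denominator is absorbed at the price of the factor
  \<open>1 + sup_norm w\<close>. The assumed inequality is then Becker's.
\<close>

lemma horizontal_shear_univalent:
  fixes c :: real
  assumes shear: "horizontal_shear C (\<lambda>z. of_real c * w z) H G"
    and w: "w holomorphic_on unit_disc" "\<And>z. z \<in> unit_disc \<Longrightarrow> cmod (w z) < 1"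
    and c: "0 \<le> c" "c \<le> 1 / 2"
    and C: "\<And>z. z \<in> unit_disc \<Longrightarrow> (C has_field_derivative d z) (at z)"
    and d: "d holomorphic_on unit_disc" "\<And>z. z \<in> unit_disc \<Longrightarrow> d z \<noteq> 0"
    and bound: "\<And>z. z \<in> unit_disc \<Longrightarrow> (1 - (cmod z)\<^sup>2) * cmod (z * deriv d z)
         + 2 * c * hyperbolic_norm w * (1 + sup_norm w) * cmod z * cmod (d z) \<le> cmod (d z)"
    and \<epsilon>: "cmod \<epsilon> = 1"
  shows "inj_on (\<lambda>z. H z + \<epsilon> * G z) unit_disc"
proof -
  define \<omega> where "\<omega> z = of_real c * w z" for z
  have HG: "H holomorphic_on unit_disc" "G holomorphic_on unit_disc"
    and C_eq: "\<And>z. z \<in> unit_disc \<Longrightarrow> H z - G z = C z"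
    and G': "\<And>z. z \<in> unit_disc \<Longrightarrow> deriv G z = \<omega> z * deriv H z"
    using shear by (auto simp: horizontal_shear_def \<omega>_def)
  have HGder: "(H has_field_derivative deriv H z) (at z)" "(G has_field_derivative deriv G z) (at z)"
    if "z \<in> unit_disc" for z using HG that by (auto intro!: holomorphic_derivI)
  have norm_\<omega>: "cmod (\<omega> z) = c * cmod (w z)" for z using c by (simp add: \<omega>_def norm_mult)
  have cw: "c * cmod (w z) < 1" if "z \<in> unit_disc" for z
  proof -
    have "c * cmod (w z) \<le> 1 / 2 * 1" using c w(2)[OF that] by (intro mult_mono) auto
    then show ?thesis by simp
  qed
  have lower: "1 - c * cmod (w z) \<le> cmod (1 - \<omega> z)" "1 - c * cmod (w z) \<le> cmod (1 + \<epsilon> * \<omega> z)" for z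
    using norm_triangle_ineq2[of 1 "\<omega> z"] norm_diff_ineq[of 1 "\<epsilon> * \<omega> z"] \<epsilon>
    by (simp_all add: norm_\<omega> norm_mult)
  have ne: "1 - \<omega> z \<noteq> 0" "1 + \<epsilon> * \<omega> z \<noteq> 0" if "z \<in> unit_disc" for z
    using lower[of z] cw[OF that] by auto
  have H': "deriv H z * (1 - \<omega> z) = d z" if z: "z \<in> unit_disc" for z
  proof -
    have "((\<lambda>z. H z - G z) has_field_derivative deriv H z - deriv G z) (at z)"
      using HGder[OF z] by (rule DERIV_diff)
    then have "(C has_field_derivative deriv H z - deriv G z) (at z)"
      by (rule has_field_derivative_transform_within_open[where S=unit_disc]) (use z C_eq in auto)
    then have "deriv H z - deriv G z = d z" using C[OF z] by (rule DERIV_unique)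
    then show ?thesis by (simp add: G'[OF z] algebra_simps)
  qed
  let ?K = "\<lambda>z. H z + \<epsilon> * G z"
  have K': "deriv ?K z = (1 + \<epsilon> * \<omega> z) / (1 - \<omega> z) * d z" if z: "z \<in> unit_disc" for z
  proof -
    have "(?K has_field_derivative deriv H z + \<epsilon> * deriv G z) (at z)"
      using HGder[OF z] by (intro DERIV_add DERIV_cmult)
    then have "deriv ?K z = (1 + \<epsilon> * \<omega> z) * deriv H z"
      by (simp add: DERIV_imp_deriv G'[OF z] algebra_simps)
    also have "deriv H z = d z / (1 - \<omega> z)" using H'[OF z] ne(1)[OF z] by (simp add: eq_divide_eq)
    finally show ?thesis by simp
  qed
  show ?thesis
  proof (rule Becker_univalence_criterion)
    show "?K holomorphic_on unit_disc" using HG by (intro holomorphic_intros)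
    show "deriv ?K z \<noteq> 0" if "z \<in> unit_disc" for z
      using K'[OF that] ne[OF that] d(2)[OF that] by simp
    fix z assume z: "z \<in> unit_disc"
    have w': "(w has_field_derivative deriv w z) (at z)" using w(1) z by (simp add: holomorphic_derivI)
    have d': "(d has_field_derivative deriv d z) (at z)" using d(1) z by (simp add: holomorphic_derivI)
    have \<omega>': "(\<omega> has_field_derivative of_real c * deriv w z) (at z)"
      unfolding \<omega>_def by (intro DERIV_cmult w')
    define q where "q = (1 + \<epsilon> * \<omega> z) / (1 - \<omega> z)"
    have "((\<lambda>z. (1 + \<epsilon> * \<omega> z) / (1 - \<omega> z) * d z) has_field_derivative
       (1 + \<epsilon>) * (of_real c * deriv w z) / (1 - \<omega> z)\<^sup>2 * d z + q * deriv d z) (at z)"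
      by (rule derivative_eq_intros \<omega>' d' refl ne[OF z] | simp)+
         (use ne[OF z] in \<open>simp add: q_def power2_eq_square field_simps\<close>)
    then have "(deriv ?K has_field_derivative
       (1 + \<epsilon>) * (of_real c * deriv w z) / (1 - \<omega> z)\<^sup>2 * d z + q * deriv d z) (at z)"
      by (rule has_field_derivative_transform_within_open[where S=unit_disc]) (use z K' in auto)
    then have "deriv (deriv ?K) z = (1 + \<epsilon>) * (of_real c * deriv w z) / (1 - \<omega> z)\<^sup>2 * d z + q * deriv d z"
      by (rule DERIV_imp_deriv)
    also have "\<dots> = q * ((1 + \<epsilon>) * (of_real c * deriv w z) / ((1 - \<omega> z) * (1 + \<epsilon> * \<omega> z)) * d z + deriv d z)"
    proof -
      have "X / (1 - \<omega> z)\<^sup>2 = q * (X / ((1 - \<omega> z) * (1 + \<epsilon> * \<omega> z)))" for X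
        using ne[OF z] by (simp add: q_def power2_eq_square)
      then show ?thesis by (simp only: distrib_left mult.assoc)
    qed
    finally have K'': "deriv (deriv ?K) z =
        q * ((1 + \<epsilon>) * (of_real c * deriv w z) / ((1 - \<omega> z) * (1 + \<epsilon> * \<omega> z)) * d z + deriv d z)" .
    let ?x = "cmod (w z)" and ?r = "cmod z" and ?W = "hyperbolic_norm w" and ?S = "sup_norm w"
    let ?m = "(1 + \<epsilon>) * (of_real c * deriv w z) / ((1 - \<omega> z) * (1 + \<epsilon> * \<omega> z))"
    have r: "0 \<le> 1 - ?r\<^sup>2" using z by (simp add: power_le_one)
    have W: "0 \<le> ?W" using hyperbolic_norm_nonneg[OF w] .
    have m: "(1 - ?r\<^sup>2) * cmod ?m \<le> 2 * c * ?W * (1 + ?S)"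
    proof -
      have "cmod (1 + \<epsilon>) \<le> 2" using norm_triangle_ineq[of 1 \<epsilon>] \<epsilon> by simp
      moreover have "c * (cmod (deriv w z) * (1 - ?r\<^sup>2)) \<le> c * (?W * (1 - ?x\<^sup>2))"
        using hyperbolic_norm_upper[OF w z] c(1) by (rule mult_left_mono)
      ultimately have "cmod (1 + \<epsilon>) * (c * (cmod (deriv w z) * (1 - ?r\<^sup>2))) \<le> 2 * (c * (?W * (1 - ?x\<^sup>2)))"
        by (rule mult_mono) (use c r in auto)
      also have "1 - ?x\<^sup>2 \<le> (1 + ?S) * (1 - c * ?x)\<^sup>2"
      proof -
        have "c * ?x \<le> 1 / 2 * ?x" using c by (intro mult_right_mono) auto
        moreover have "1 - 2 * (c * ?x) \<le> (1 - c * ?x)\<^sup>2"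
          using zero_le_power2[of "c * ?x"] by (simp add: power2_diff)
        ultimately have "1 - ?x \<le> (1 - c * ?x)\<^sup>2" by simp
        then have "(1 + ?x) * (1 - ?x) \<le> (1 + ?S) * (1 - c * ?x)\<^sup>2"
          using sup_norm_upper[of w z, OF w(2) z] sup_norm_nonneg[of w, OF w(2)] w(2)[OF z]
          by (intro mult_mono) auto
        then show ?thesis by (simp add: power2_eq_square algebra_simps)
      qed
      finally have "cmod (1 + \<epsilon>) * (c * (cmod (deriv w z) * (1 - ?r\<^sup>2)))
          \<le> 2 * c * ?W * (1 + ?S) * (1 - c * ?x)\<^sup>2"
        using c W by (simp add: mult_left_mono mult.assoc)
      also have "(1 - c * ?x)\<^sup>2 \<le> cmod (1 - \<omega> z) * cmod (1 + \<epsilon> * \<omega> z)"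
        unfolding power2_eq_square using lower[of z] cw[OF z] by (intro mult_mono) auto
      finally have "cmod (1 + \<epsilon>) * (c * (cmod (deriv w z) * (1 - ?r\<^sup>2)))
          \<le> 2 * c * ?W * (1 + ?S) * (cmod (1 - \<omega> z) * cmod (1 + \<epsilon> * \<omega> z))"
        using c W sup_norm_nonneg[OF w(2)] by (simp add: mult_left_mono)
      then show ?thesis
        using ne[OF z] c by (simp add: norm_mult norm_divide divide_le_eq mult_ac)
    qed
    have "(1 - ?r\<^sup>2) * cmod (z * (?m * d z + deriv d z))
        \<le> (1 - ?r\<^sup>2) * (cmod (z * (?m * d z)) + cmod (z * deriv d z))"
      unfolding distrib_left[of z] using r by (intro mult_left_mono norm_triangle_ineq)
    also have "\<dots> = ((1 - ?r\<^sup>2) * cmod ?m) * (?r * cmod (d z)) + (1 - ?r\<^sup>2) * cmod (z * deriv d z)"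
      by (simp only: norm_mult distrib_left mult_ac)
    also have "\<dots> \<le> (2 * c * ?W * (1 + ?S)) * (?r * cmod (d z)) + (1 - ?r\<^sup>2) * cmod (z * deriv d z)"
      by (intro add_right_mono mult_right_mono m) simp
    also have "\<dots> \<le> cmod (d z)" using bound[OF z] by (simp only: mult.assoc add.commute)
    finally have "cmod q * ((1 - ?r\<^sup>2) * cmod (z * (?m * d z + deriv d z))) \<le> cmod q * cmod (d z)"
      by (rule mult_left_mono) simp
    then show "(1 - ?r\<^sup>2) * cmod (z * deriv (deriv ?K) z) \<le> cmod (deriv ?K z)"
      unfolding K'' K'[OF z] q_def[symmetric] by (simp add: norm_mult mult_ac)
  qed
qed

text \<open>
  If \<open>H + \<mu> * cnj G\<close> takes the same value at two points, the increments \<open>a\<close> of \<open>H\<close> and \<open>b\<close> of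
  \<open>G\<close> have equal modulus, so \<open>a + \<epsilon> * b = 0\<close> for some unimodular \<open>\<epsilon>\<close>, and \<open>H + \<epsilon> * G\<close> is not
  injective either.
\<close>

lemma SHU_of_analytic_univalence:
  assumes "H holomorphic_on unit_disc" "G holomorphic_on unit_disc" "sense_preserving H G"
    and inj: "\<And>\<epsilon>. cmod \<epsilon> = 1 \<Longrightarrow> inj_on (\<lambda>z. H z + \<epsilon> * G z) unit_disc"
  shows "harmonic_map H G \<in> SHU"
proof -
  have "inj_on (\<lambda>z. H z + \<mu> * cnj (G z)) unit_disc" if \<mu>: "cmod \<mu> = 1" for \<mu>
  proof (rule inj_onI)
    fix x y assume xy: "x \<in> unit_disc" "y \<in> unit_disc" "H x + \<mu> * cnj (G x) = H y + \<mu> * cnj (G y)"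
    define a b where "a = H x - H y" and "b = G x - G y"
    have ab: "a = - (\<mu> * cnj b)" using xy(3) by (simp add: a_def b_def algebra_simps eq_neg_iff_add_eq_0)
    define \<epsilon> where "\<epsilon> = (if b = 0 then 1 else \<mu> * cnj b / b)"
    have "cmod \<epsilon> = 1" using \<mu> by (simp add: \<epsilon>_def norm_mult norm_divide)
    moreover have "a + \<epsilon> * b = 0" using ab by (simp add: \<epsilon>_def)
    then have "H x + \<epsilon> * G x = H y + \<epsilon> * G y" by (simp add: a_def b_def algebra_simps)
    ultimately show "x = y" using inj_onD[OF inj] xy(1,2) by blast
  qed
  then show ?thesis unfolding SHU_def using assms(1-3) by blast
qed

section \<open>The range of the exponent\<close>

text \<open>
  Here \<open>X\<close> stands for \<open>hyperbolic_norm w * (1 + sup_norm w)\<close>. With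
  \<open>B = \<beta> + 2 * (1 + \<beta>) * X\<close>, the bracket in the second conclusion is the quadratic
  \<open>2 * \<gamma> + 1 + B * r - (1 - \<beta>) * r\<^sup>2\<close>. The condition \<open>2 * (1 - \<beta>) \<le> B\<close>, automatic for
  \<open>\<beta> \<ge> 1\<close>, makes its maximum over \<open>{0..1}\<close> occur at \<open>r = 1\<close>, with the value
  \<open>2 * (\<gamma> + \<beta> + (1 + \<beta>) * X)\<close>.
\<close>

lemma parameter_bound_endpoint:
  fixes \<alpha> \<beta> \<gamma> X r :: real
  assumes nonneg: "0 \<le> \<alpha>" "1 \<le> \<gamma>" "0 \<le> \<beta>" "0 \<le> X" and r: "0 \<le> r" "r \<le> 1"
    and regime: "2 * (1 - \<beta>) \<le> \<beta> + 2 * (1 + \<beta>) * X"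
    and \<alpha>: "\<alpha> \<le> 1 / (2 * (\<gamma> + \<beta> + (1 + \<beta>) * X))"
  shows "\<alpha> * (1 + \<beta>) \<le> 1 / 2"
    and "\<alpha> * (2 * \<gamma> + (1 - r\<^sup>2) + \<beta> * r * (1 + r) + 2 * (1 + \<beta>) * X * r) \<le> 1"
proof -
  have X: "0 \<le> (1 + \<beta>) * X" using nonneg by simp
  have \<alpha>': "\<alpha> * (2 * (\<gamma> + \<beta> + (1 + \<beta>) * X)) \<le> 1"
    using \<alpha> X nonneg by (simp add: pos_le_divide_eq)
  have "\<alpha> * (2 * (1 + \<beta>)) \<le> \<alpha> * (2 * (\<gamma> + \<beta> + (1 + \<beta>) * X))"
  proof (rule mult_left_mono[OF _ nonneg(1)])
    have "2 * (1 + \<beta>) \<le> 2 * (\<gamma> + \<beta> + Y)" if "0 \<le> Y" for Y using that nonneg(2) by simp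
    from this[OF X] show "2 * (1 + \<beta>) \<le> 2 * (\<gamma> + \<beta> + (1 + \<beta>) * X)" .
  qed
  then show "\<alpha> * (1 + \<beta>) \<le> 1 / 2" using \<alpha>' by linarith
  have "(1 - \<beta>) * (1 + r) \<le> \<beta> + 2 * (1 + \<beta>) * X"
  proof (cases "\<beta> \<le> 1")
    case True
    then have "(1 - \<beta>) * (1 + r) \<le> (1 - \<beta>) * 2" using r by (intro mult_left_mono) auto
    then show ?thesis using regime by simp
  next
    case False
    then have "(1 - \<beta>) * (1 + r) \<le> 0" using r by (simp add: mult_le_0_iff)
    also have "0 \<le> \<beta> + 2 * (1 + \<beta>) * X" using nonneg by (intro add_nonneg_nonneg mult_nonneg_nonneg) auto
    finally show ?thesis .
  qed
  then have "(1 - \<beta>) * (1 + r) * (1 - r) \<le> (\<beta> + 2 * (1 + \<beta>) * X) * (1 - r)"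
    using r by (intro mult_right_mono) auto
  then have "2 * \<gamma> + (1 - r\<^sup>2) + \<beta> * r * (1 + r) + 2 * (1 + \<beta>) * X * r \<le> 2 * (\<gamma> + \<beta> + (1 + \<beta>) * X)"
    by (simp add: power2_eq_square algebra_simps)
  then have "\<alpha> * (2 * \<gamma> + (1 - r\<^sup>2) + \<beta> * r * (1 + r) + 2 * (1 + \<beta>) * X * r)
      \<le> \<alpha> * (2 * (\<gamma> + \<beta> + (1 + \<beta>) * X))"
    using nonneg by (intro mult_left_mono)
  then show "\<alpha> * (2 * \<gamma> + (1 - r\<^sup>2) + \<beta> * r * (1 + r) + 2 * (1 + \<beta>) * X * r) \<le> 1"
    using \<alpha>' by linarith
qed

text \<open>
  For \<open>\<beta> < 1\<close> the same quadratic is bounded on the whole line by its value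
  \<open>2 * \<gamma> + 1 + B\<^sup>2 / (4 * (1 - \<beta>))\<close> at the vertex \<open>r = B / (2 * (1 - \<beta>))\<close>. The bound
  \<open>\<alpha> * (1 + \<beta>) \<le> 1 / 2\<close> comes down to \<open>(3 * \<beta> - 2)\<^sup>2 \<ge> 0\<close>.
\<close>

lemma parameter_bound_vertex:
  fixes \<alpha> \<beta> \<gamma> X r :: real
  assumes nonneg: "0 \<le> \<alpha>" "1 \<le> \<gamma>" "0 \<le> \<beta>" "\<beta> < 1" "0 \<le> X"
    and \<alpha>: "\<alpha> \<le> 4 * (1 - \<beta>) / (4 * (2 * \<gamma> + 1) * (1 - \<beta>) + (\<beta> + 2 * (1 + \<beta>) * X)\<^sup>2)"
  shows "\<alpha> * (1 + \<beta>) \<le> 1 / 2"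
    and "\<alpha> * (2 * \<gamma> + (1 - r\<^sup>2) + \<beta> * r * (1 + r) + 2 * (1 + \<beta>) * X * r) \<le> 1"
proof -
  define B where "B = \<beta> + 2 * (1 + \<beta>) * X"
  have B: "\<beta> \<le> B" using nonneg by (simp add: B_def)
  have "0 < 4 * (2 * \<gamma> + 1) * (1 - \<beta>)" using nonneg by simp
  then have "0 < 4 * (2 * \<gamma> + 1) * (1 - \<beta>) + B\<^sup>2" by (simp add: add_pos_nonneg)
  then have \<alpha>': "\<alpha> * (4 * (2 * \<gamma> + 1) * (1 - \<beta>) + B\<^sup>2) \<le> 4 * (1 - \<beta>)"
    using \<alpha> by (simp add: pos_le_divide_eq B_def)
  have "8 * (1 - \<beta>) * (1 + \<beta>) \<le> 12 * (1 - \<beta>) + \<beta>\<^sup>2"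
    using zero_le_power2[of "3 * \<beta> - 2"] by (simp add: power2_eq_square algebra_simps)
  also have "12 * (1 - \<beta>) \<le> 4 * (2 * \<gamma> + 1) * (1 - \<beta>)"
    using nonneg by (intro mult_right_mono) auto
  also have "\<beta>\<^sup>2 \<le> B\<^sup>2" using B nonneg by (intro power_mono) auto
  finally have "8 * (1 - \<beta>) * (1 + \<beta>) \<le> 4 * (2 * \<gamma> + 1) * (1 - \<beta>) + B\<^sup>2" by simp
  then have "\<alpha> * (8 * (1 - \<beta>) * (1 + \<beta>)) \<le> 4 * (1 - \<beta>)"
    using \<alpha>' nonneg by (meson mult_left_mono order_trans)
  moreover have "(\<alpha> * (1 + \<beta>)) * (8 * (1 - \<beta>)) = \<alpha> * (8 * (1 - \<beta>) * (1 + \<beta>))"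
    by (simp only: mult_ac)
  ultimately have "(\<alpha> * (1 + \<beta>)) * (8 * (1 - \<beta>)) \<le> 1 / 2 * (8 * (1 - \<beta>))" by linarith
  then show "\<alpha> * (1 + \<beta>) \<le> 1 / 2" using nonneg by (simp only: mult_le_cancel_right) auto
  have "4 * (1 - \<beta>) * (2 * \<gamma> + (1 - r\<^sup>2) + \<beta> * r * (1 + r) + 2 * (1 + \<beta>) * X * r)
      = 4 * (2 * \<gamma> + 1) * (1 - \<beta>) + B\<^sup>2 - (B - 2 * (1 - \<beta>) * r)\<^sup>2"
    by (simp add: B_def power2_eq_square algebra_simps)
  also have "\<dots> \<le> 4 * (2 * \<gamma> + 1) * (1 - \<beta>) + B\<^sup>2" by simp
  finally have "\<alpha> * (4 * (1 - \<beta>) * (2 * \<gamma> + (1 - r\<^sup>2) + \<beta> * r * (1 + r) + 2 * (1 + \<beta>) * X * r)) \<le> 4 * (1 - \<beta>)"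
    using \<alpha>' nonneg by (meson mult_left_mono order_trans)
  then have "(\<alpha> * (2 * \<gamma> + (1 - r\<^sup>2) + \<beta> * r * (1 + r) + 2 * (1 + \<beta>) * X * r)) * (4 * (1 - \<beta>)) \<le> 1 * (4 * (1 - \<beta>))"
    by (simp only: mult_ac mult_1_left)
  then show "\<alpha> * (2 * \<gamma> + (1 - r\<^sup>2) + \<beta> * r * (1 + r) + 2 * (1 + \<beta>) * X * r) \<le> 1"
    using nonneg by (simp only: mult_le_cancel_right) auto
qed

theorem theorem4p4:
  fixes \<alpha> \<beta> \<gamma> \<theta> :: real
    and L :: "(complex \<Rightarrow> complex) set"
    and \<phi> w H G :: "complex \<Rightarrow> complex"
  assumes "\<alpha> \<ge> 0" and "1 \<le> \<gamma>"
    and "linear_invariant_family L" and "family_order L = ereal \<gamma>"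
    and "\<phi> \<in> L" and "inj_on \<phi> unit_disc"
    and "0 \<le> \<theta>" and "\<theta> < pi"
    and "w holomorphic_on unit_disc" and "\<And>z. z \<in> unit_disc \<Longrightarrow> cmod (w z) < 1"
    and "horizontal_shear (C_op_rot \<theta> \<alpha> \<beta> \<phi>) (\<lambda>z. of_real (\<alpha> * (1 + \<beta>)) * w z) H G"
    and "sense_preserving H G"
  shows
    "(\<beta> \<ge> 1 \<longrightarrow>
        \<alpha> \<le> 1 / (2 * (\<gamma> + \<beta> + (1 + \<beta>) * hyperbolic_norm w * (1 + sup_norm w))) \<longrightarrow>
        harmonic_map H G \<in> SHU) \<and>
     (0 \<le> \<beta> \<and> \<beta> < 1 \<longrightarrow>
        (\<beta> + 2 * (1 + \<beta>) * hyperbolic_norm w * (1 + sup_norm w) \<le> 2 * (1 - \<beta>) \<longrightarrow>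
           \<alpha> \<le> 4 * (1 - \<beta>) / (4 * (2 * \<gamma> + 1) * (1 - \<beta>)
                  + (\<beta> + 2 * (1 + \<beta>) * hyperbolic_norm w * (1 + sup_norm w))\<^sup>2) \<longrightarrow>
           harmonic_map H G \<in> SHU) \<and>
        (\<beta> + 2 * (1 + \<beta>) * hyperbolic_norm w * (1 + sup_norm w) > 2 * (1 - \<beta>) \<longrightarrow>
           \<alpha> \<le> 1 / (2 * (\<gamma> + \<beta> + (1 + \<beta>) * hyperbolic_norm w * (1 + sup_norm w))) \<longrightarrow>
           harmonic_map H G \<in> SHU))"
proof -
  note inj = \<open>inj_on \<phi> unit_disc\<close> and w = \<open>w holomorphic_on unit_disc\<close> assms(10)
    and shear = assms(11)
  define X where "X = hyperbolic_norm w * (1 + sup_norm w)"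
  have X: "0 \<le> X"
    using hyperbolic_norm_nonneg[OF w] sup_norm_nonneg[OF w(2)] by (simp add: X_def)
  have \<phi>: "\<phi> holomorphic_on unit_disc" "\<phi> 0 = 0" "deriv \<phi> 0 = 1"
    using assms(3,5) by (auto simp: linear_invariant_family_def)
  have "0 < \<gamma>" using \<open>1 \<le> \<gamma>\<close> by simp
  \<comment> \<open>The only place where the order of the family enters.\<close>
  have log_bound: "(1 - (cmod a)\<^sup>2) * cmod (a * deriv \<phi> a) \<le> 2 * \<gamma> * cmod (\<phi> a)" if "a \<in> unit_disc" for a
    using univalent_logarithmic_derivative_bound[OF \<phi>(1) inj \<phi>(2) _ \<open>0 < \<gamma>\<close> that]
      linear_invariant_second_derivative_bound[OF assms(3,4,5)] by blast
  have SHU: "harmonic_map H G \<in> SHU"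
    if \<beta>: "0 \<le> \<beta>" and c: "\<alpha> * (1 + \<beta>) \<le> 1 / 2"
      and total: "\<And>r. 0 \<le> r \<Longrightarrow> r \<le> 1 \<Longrightarrow>
        \<alpha> * (2 * \<gamma> + (1 - r\<^sup>2) + \<beta> * r * (1 + r) + 2 * (1 + \<beta>) * X * r) \<le> 1"
  proof (rule SHU_of_analytic_univalence[OF _ _ assms(12)])
    show "H holomorphic_on unit_disc" "G holomorphic_on unit_disc"
      using shear by (auto simp: horizontal_shear_def)
    fix \<epsilon> :: complex assume \<epsilon>: "cmod \<epsilon> = 1"
    have "0 \<le> \<gamma>" using \<open>1 \<le> \<gamma>\<close> by simp
    obtain d where d: "d holomorphic_on unit_disc" "\<And>z. z \<in> unit_disc \<Longrightarrow> d z \<noteq> 0"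
        "\<And>z. z \<in> unit_disc \<Longrightarrow> (C_op_rot \<theta> \<alpha> \<beta> \<phi> has_field_derivative d z) (at z)"
        "\<And>z. z \<in> unit_disc \<Longrightarrow> (1 - (cmod z)\<^sup>2) * cmod (z * deriv d z)
           \<le> \<alpha> * (2 * \<gamma> + (1 - (cmod z)\<^sup>2) + \<beta> * cmod z * (1 + cmod z)) * cmod (d z)"
      using rotated_C_op[OF \<phi>(1) inj \<phi>(2,3) \<open>\<alpha> \<ge> 0\<close> \<beta> \<open>0 \<le> \<gamma>\<close> log_bound] by blast
    show "inj_on (\<lambda>z. H z + \<epsilon> * G z) unit_disc"
    proof (rule horizontal_shear_univalent[OF shear w _ c d(3,1,2) _ \<epsilon>])
      show "0 \<le> \<alpha> * (1 + \<beta>)" using \<open>\<alpha> \<ge> 0\<close> \<beta> by simp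
      fix z assume z: "z \<in> unit_disc"
      let ?r = "cmod z"
      have "(1 - ?r\<^sup>2) * cmod (z * deriv d z)
          + 2 * (\<alpha> * (1 + \<beta>)) * hyperbolic_norm w * (1 + sup_norm w) * ?r * cmod (d z)
        \<le> \<alpha> * (2 * \<gamma> + (1 - ?r\<^sup>2) + \<beta> * ?r * (1 + ?r)) * cmod (d z)
          + 2 * (\<alpha> * (1 + \<beta>)) * hyperbolic_norm w * (1 + sup_norm w) * ?r * cmod (d z)"
        by (intro add_right_mono d(4)[OF z])
      also have "\<dots> = \<alpha> * (2 * \<gamma> + (1 - ?r\<^sup>2) + \<beta> * ?r * (1 + ?r) + 2 * (1 + \<beta>) * X * ?r) * cmod (d z)"
        by (simp add: X_def algebra_simps)
      also have "\<dots> \<le> 1 * cmod (d z)"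
        using z by (intro mult_right_mono total) auto
      finally show "(1 - ?r\<^sup>2) * cmod (z * deriv d z)
          + 2 * (\<alpha> * (1 + \<beta>)) * hyperbolic_norm w * (1 + sup_norm w) * ?r * cmod (d z) \<le> cmod (d z)"
        by simp
    qed
  qed
  have endpoint: "harmonic_map H G \<in> SHU"
    if "0 \<le> \<beta>" "2 * (1 - \<beta>) \<le> \<beta> + 2 * (1 + \<beta>) * X" "\<alpha> \<le> 1 / (2 * (\<gamma> + \<beta> + (1 + \<beta>) * X))"
  proof (rule SHU[OF that(1)])
    note bounds = parameter_bound_endpoint[OF \<open>\<alpha> \<ge> 0\<close> \<open>1 \<le> \<gamma>\<close> that(1) X _ _ that(2,3)]
    show "\<alpha> * (1 + \<beta>) \<le> 1 / 2" by (rule bounds(1)[of 0]) auto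
    show "\<alpha> * (2 * \<gamma> + (1 - r\<^sup>2) + \<beta> * r * (1 + r) + 2 * (1 + \<beta>) * X * r) \<le> 1"
      if "0 \<le> r" "r \<le> 1" for r using bounds(2)[OF that] .
  qed
  have vertex: "harmonic_map H G \<in> SHU"
    if "0 \<le> \<beta>" "\<beta> < 1"
      "\<alpha> \<le> 4 * (1 - \<beta>) / (4 * (2 * \<gamma> + 1) * (1 - \<beta>) + (\<beta> + 2 * (1 + \<beta>) * X)\<^sup>2)"
    using parameter_bound_vertex[OF \<open>\<alpha> \<ge> 0\<close> \<open>1 \<le> \<gamma>\<close> that(1,2) X that(3)] SHU[OF that(1)] by blast
  have large: "2 * (1 - \<beta>) \<le> \<beta> + 2 * (1 + \<beta>) * X" if "1 \<le> \<beta>"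
  proof -
    have "2 * (1 - \<beta>) \<le> \<beta> + 0" using that by simp
    also have "0 \<le> 2 * (1 + \<beta>) * X" using that X by simp
    finally show ?thesis by simp
  qed
  show ?thesis
    using endpoint vertex large unfolding X_def
    by (simp only: mult.assoc) (meson less_imp_le order_trans zero_le_one)
qed

end
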